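(* Let $(X,\mu)$ be a $\sigma$-finite measure space and let $(Y_j,\nu_j)$, $1\le j\le d$, be measure spaces. Suppose that the linear operators $T_j:\mathcal{S}(Y_j)\to\mathcal{M}(X)$ are positive and that each $T_j$ saturates $X$. Suppose that $1\le p_j\le\infty$, $\alpha_j>0$, $\sum_{j=1}^d\alpha_j=1$ and that, for some $A\ge0$, $$\int_X\prod_{j=1}^d (T_jf_j)^{\alpha_j}\,d\mu\le A\prod_{j=1}^d\|f_j\|_{L^{p_j}(Y_j)}^{\alpha_j}$$ for all nonnegative simple functions $f_j\in\mathcal{S}(Y_j)$, $1\le j\le d$. Then there exist nonnegative measurable functions $g_1,\dots,g_d$ on $X$ such that $$1\le\prod_{j=1}^d g_j(x)^{\alpha_j}\quad\text{for a.e. }x\in X,$$ and such that for each $j$, $$\int_X g_j(x)\,T_jf_j(x)\,d\mu(x)\le A\,\|f_j\|_{L^{p_j}(Y_j)}$$ for all simple functions $f_j\in\mathcal{S}(Y_j)$.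
   Context: $\mathcal{S}(Y)$ denotes the real-valued simple functions on a measure space $Y$ (finite linear combinations of characteristic functions of measurable sets of finite measure), and $\mathcal{M}(X)$ the real-valued measurable functions on $X$. A linear map $T:\mathcal{S}(Y)\to\mathcal{M}(X)$ is positive if $f\ge0$ a.e. on $Y$ implies $Tf\ge0$ a.e. on $X$. $T$ saturates $X$ if for each measurable $E\subseteq X$ of positive measure there exist a measurable $E'\subseteq E$ with $\mu(E')>0$ and a nonnegative $h\in\mathcal{S}(Y)$ such that $Th>0$ a.e. on $E'$. *)

theory Defs
  imports "HOL-Analysis.Analysis" "HOL-Probability.Essential_Supremum"
begin

text \<open>Functions on a measure space are represented by total functions on the underlying type;
  members of \<open>simple_functions Y\<close> automatically vanish outside \<open>space Y\<close>.\<close>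

definition simple_functions :: "'b measure \<Rightarrow> ('b \<Rightarrow> real) set" where
  "simple_functions Y =
     {f. \<exists>(F :: 'b set set) (c :: 'b set \<Rightarrow> real). finite F \<and>
           (\<forall>E\<in>F. E \<in> sets Y \<and> emeasure Y E < \<infinity>) \<and>
           f = (\<lambda>y. \<Sum>E\<in>F. c E * indicator E y)}"

text \<open>Elements of the target space are identified when they agree almost everywhere, so linearity
  is required almost everywhere only. This covers operators defined on genuine functions as well
  as operators defined on classes modulo null sets (via any choice of representatives).\<close>

definition linear_operator :: "'b measure \<Rightarrow> 'a measure \<Rightarrow> (('b \<Rightarrow> real) \<Rightarrow> 'a \<Rightarrow> real) \<Rightarrow> bool" where
  "linear_operator Y X T \<longleftrightarrow>
     (\<forall>f\<in>simple_functions Y. T f \<in> borel_measurable X) \<and>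
     (\<forall>f\<in>simple_functions Y. \<forall>g\<in>simple_functions Y.
        AE x in X. T (\<lambda>y. f y + g y) x = T f x + T g x) \<and>
     (\<forall>f\<in>simple_functions Y. \<forall>c. AE x in X. T (\<lambda>y. c * f y) x = c * T f x)"

definition positive_operator :: "'b measure \<Rightarrow> 'a measure \<Rightarrow> (('b \<Rightarrow> real) \<Rightarrow> 'a \<Rightarrow> real) \<Rightarrow> bool" where
  "positive_operator Y X T \<longleftrightarrow>
     (\<forall>f\<in>simple_functions Y. (AE y in Y. 0 \<le> f y) \<longrightarrow> (AE x in X. 0 \<le> T f x))"

definition saturates :: "'b measure \<Rightarrow> 'a measure \<Rightarrow> (('b \<Rightarrow> real) \<Rightarrow> 'a \<Rightarrow> real) \<Rightarrow> bool" where
  "saturates Y X T \<longleftrightarrow>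
     (\<forall>E\<in>sets X. 0 < emeasure X E \<longrightarrow>
        (\<exists>E'\<in>sets X. E' \<subseteq> E \<and> 0 < emeasure X E' \<and>
           (\<exists>h\<in>simple_functions Y. (\<forall>y\<in>space Y. 0 \<le> h y) \<and>
              (AE x in X. x \<in> E' \<longrightarrow> 0 < T h x))))"

text \<open>The norm is real-valued, which is meaningful only for functions in \<open>L\<^sup>p\<close>; simple functions
  belong to every \<open>L\<^sup>p\<close>. The essential supremum is taken in the extended nonnegative reals so that
  it is \<open>0\<close> (not \<open>-\<infinity>\<close>) on a space of measure zero.\<close>

definition Lp_norm :: "ennreal \<Rightarrow> 'b measure \<Rightarrow> ('b \<Rightarrow> real) \<Rightarrow> real" where
  "Lp_norm p Y f =
     (if p = \<infinity> then enn2real (esssup Y (\<lambda>y. ennreal \<bar>f y\<bar>))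
      else (\<integral>y. \<bar>f y\<bar> powr enn2real p \<partial>Y) powr (1 / enn2real p))"

end

theory Submission
  imports Defs
begin

text \<open>
  After multiplication of the measure by an integrable positive weight, \<open>X\<close> may be assumed finite.
  For each \<open>j\<close> let \<open>K\<^sub>j\<close> be the set of all \<open>T\<^sub>j f\<close> with \<open>f \<ge> 0\<close> simple and \<open>\<parallel>f\<parallel> \<le> 1\<close>. It is a convex set
  of nonnegative functions, and the hypothesis says that the functional
  \<open>\<Phi>(u) = \<integral> G(u)\<close>, \<open>G(u) = \<Prod>\<^sub>j u\<^sub>j\<^bsup>\<alpha>\<^sub>j\<^esup>\<close>, is at most \<open>A\<close> on \<open>\<Prod>\<^sub>j K\<^sub>j\<close>. What is wanted is a tuple \<open>g\<close> with
  \<open>G(g) \<ge> 1\<close> and \<open>\<integral> g\<^sub>j u \<le> A\<close> for all \<open>u \<in> K\<^sub>j\<close>.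

  If \<open>\<Phi>\<close> had a maximiser \<open>U\<close>, the tuple \<open>g\<^sub>j = G(U) / U\<^sub>j\<close> would do. Indeed \<open>G(g) = 1\<close>, because the
  weights add up to \<open>1\<close>; and since \<open>G\<close> is concave, moving the \<open>j\<close>-th coordinate of \<open>U\<close> towards \<open>u\<close>
  gives \<open>\<integral> g\<^sub>j (u - U\<^sub>j) \<le> 0\<close>, whence \<open>\<integral> g\<^sub>j u \<le> \<integral> G(U) \<le> A\<close>. Maximisers need not exist, since
  mass can concentrate along a maximising sequence, and \<open>U\<^sub>j\<close> might vanish. Both obstacles disappear
  for a perturbed problem. In place of \<open>\<Phi>\<close> one minimises \<open>\<integral> exp (-\<epsilon> G(u))\<close>, whose integrand is
  bounded and convex in \<open>u\<close>; and \<open>K\<^sub>j\<close> is replaced by \<open>(1 - \<delta>) K\<^sub>j + \<delta> h\<^sub>j\<close>, where \<open>h\<^sub>j \<in> K\<^sub>j\<close> is positive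
  off a small set by saturation. The same computation yields \<open>g\<^sub>j = exp (-\<epsilon> G(U)) G(U) / U\<^sub>j\<close>, which is
  admissible up to an arbitrarily small error (\<open>first_order_condition\<close>, \<open>approximate_factorisation\<close>).

  The admissible \<open>g\<close> with error at most \<open>\<eta>\<close> form a convex set that shrinks with \<open>\<eta>\<close>, and all
  conditions survive almost everywhere limits by Fatou's lemma. So it remains to choose approximate
  solutions that converge. This, and the existence of minimisers, rests on one compactness principle
  of Komlos type (\<open>nested_convex_AE_convergent\<close>): from a decreasing sequence of nonempty convex sets of
  nonnegative functions one can choose members that converge almost everywhere in \<open>[0, \<infinity>]\<close>.
  Finiteness of the limits comes from the bound \<open>A\<close> together with positivity of the \<open>h\<^sub>j\<close>, that is,
  again from saturation.
\<close>

section \<open>Almost everywhere limits\<close>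

text \<open>An \<open>L\<^sup>1\<close> Cauchy sequence has an almost everywhere convergent subsequence; passing to further
  subsequences treats finitely many sequences at once.\<close>

lemma common_AE_Cauchy_subseq:
  fixes s :: "'i \<Rightarrow> nat \<Rightarrow> 'a \<Rightarrow> real"
  assumes "finite I"
    and int: "\<And>j n. j \<in> I \<Longrightarrow> integrable M (s j n)"
    and cau: "\<And>j e. j \<in> I \<Longrightarrow> 0 < e \<Longrightarrow>
      \<exists>N. \<forall>m\<ge>N. \<forall>n\<ge>N. (\<integral>x. norm (s j m x - s j n x) \<partial>M) < e"
  shows "\<exists>r. strict_mono r \<and> (\<forall>j\<in>I. AE x in M. Cauchy (\<lambda>n. s j (r n) x))"
  using assms
proof (induction I)
  case empty
  show ?case using strict_mono_id by auto
next
  case (insert i I)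
  have "\<exists>r. strict_mono r \<and> (\<forall>j\<in>I. AE x in M. Cauchy (\<lambda>n. s j (r n) x))"
    by (rule insert.IH) (use insert.prems in auto)
  then obtain r where r: "strict_mono r" "\<And>j. j \<in> I \<Longrightarrow> AE x in M. Cauchy (\<lambda>n. s j (r n) x)"
    by blast
  have "\<exists>N. \<forall>m\<ge>N. \<forall>n\<ge>N. (\<integral>x. norm (s i (r m) x - s i (r n) x) \<partial>M) < e" if "0 < e" for e
  proof -
    obtain N where "\<forall>m\<ge>N. \<forall>n\<ge>N. (\<integral>x. norm (s i m x - s i n x) \<partial>M) < e"
      using insert.prems(2)[of i e] \<open>0 < e\<close> by auto
    then show ?thesis
      using seq_suble[OF r(1)] by (meson le_trans)
  qed
  then obtain q where q: "strict_mono q" "AE x in M. Cauchy (\<lambda>n. s i (r (q n)) x)"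
    using insert.prems(1)[of i] by (rule_tac cauchy_L1_AE_cauchy_subseq[of M "\<lambda>n. s i (r n)"]) simp_all
  have "AE x in M. Cauchy (\<lambda>n. s j (r (q n)) x)" if "j \<in> I" for j
    using r(2)[OF that]
  proof eventually_elim
    case (elim x)
    then show ?case
      using Cauchy_subseq_Cauchy[OF _ q(1), of "\<lambda>n. s j (r n) x"] by (simp add: o_def)
  qed
  with q r(1) show ?case
    by (intro exI[of _ "r \<circ> q"]) (auto simp: strict_mono_def)
qed

text \<open>The compactness principle below controls \<open>exp (- f n / 2)\<close>, hence \<open>f\<close> as a sequence in
  \<open>[0, \<infinity>]\<close>; the limit \<open>0\<close> of the exponentials is the value \<open>\<infinity>\<close>.\<close>

lemma convergent_or_at_top_if_convergent_exp:
  fixes f :: "nat \<Rightarrow> real"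
  assumes "convergent (\<lambda>n. exp (- f n / 2))"
  shows "convergent f \<or> filterlim f at_top sequentially"
proof -
  obtain l where l: "(\<lambda>n. exp (- f n / 2)) \<longlonglongrightarrow> l" using assms by (auto simp: convergent_def)
  have f_eq: "f = (\<lambda>n. - 2 * ln (exp (- f n / 2)))" by auto
  have "0 \<le> l" using l by (rule LIMSEQ_le_const) auto
  then consider "0 < l" | "l = 0" by linarith
  then show ?thesis
  proof cases
    case 1
    then have "(\<lambda>n. - 2 * ln (exp (- f n / 2))) \<longlonglongrightarrow> - 2 * ln l"
      by (intro tendsto_intros l) auto
    then show ?thesis using f_eq by (auto simp: convergent_def)
  next
    case 2
    have "filterlim (\<lambda>n. exp (- f n / 2)) (at_right 0) sequentially"
      using l 2 by (auto simp: filterlim_at intro!: always_eventually)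
    then have "filterlim (\<lambda>n. ln (exp (- f n / 2))) at_bot sequentially"
      by (rule filterlim_compose[OF ln_at_0])
    then have "filterlim (\<lambda>n. 2 * (f n / 2)) at_top sequentially"
      by (intro filterlim_tendsto_pos_mult_at_top[OF tendsto_const])
        (auto simp: filterlim_uminus_at_top)
    then show ?thesis by simp
  qed
qed

text \<open>Fatou's lemma, in the form in which every constraint is passed to a limit below.\<close>

lemma nn_integral_le_if_AE_tendsto:
  fixes f :: "nat \<Rightarrow> 'a \<Rightarrow> ennreal"
  assumes meas: "\<And>n. f n \<in> borel_measurable M"
    and lim: "AE x in M. (\<lambda>n. f n x) \<longlonglongrightarrow> g x"
    and le: "\<And>n. (\<integral>\<^sup>+x. f n x \<partial>M) \<le> b n" and b: "b \<longlonglongrightarrow> B"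
  shows "(\<integral>\<^sup>+x. g x \<partial>M) \<le> B"
proof -
  have "(\<integral>\<^sup>+x. g x \<partial>M) = (\<integral>\<^sup>+x. liminf (\<lambda>n. f n x) \<partial>M)"
    using lim by (intro nn_integral_cong_AE, eventually_elim) (auto dest: lim_imp_Liminf[rotated])
  also have "\<dots> \<le> liminf (\<lambda>n. \<integral>\<^sup>+x. f n x \<partial>M)" by (rule nn_integral_liminf[OF meas])
  also have "\<dots> \<le> liminf b" by (intro Liminf_mono always_eventually allI le)
  also have "\<dots> = B" using b by (auto dest: lim_imp_Liminf[rotated])
  finally show ?thesis .
qed

text \<open>By Fatou's lemma the lower limit of the \<open>f n\<close> is integrable, hence finite almost everywhere. This
  excludes the limit \<open>\<infinity>\<close>.\<close>

lemma AE_not_at_top_if_nn_integral_bounded: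
  fixes f :: "nat \<Rightarrow> 'a \<Rightarrow> real"
  assumes [measurable]: "\<And>n. f n \<in> borel_measurable M"
    and bound: "\<And>n. (\<integral>\<^sup>+x. ennreal (f n x) \<partial>M) \<le> ennreal B"
  shows "AE x in M. \<not> filterlim (\<lambda>n. f n x) at_top sequentially"
proof -
  have "(\<integral>\<^sup>+x. liminf (\<lambda>n. ennreal (f n x)) \<partial>M) \<le> liminf (\<lambda>n. \<integral>\<^sup>+x. ennreal (f n x) \<partial>M)"
    by (rule nn_integral_liminf) measurable
  also have "\<dots> \<le> ennreal B"
    using bound by (intro Liminf_le) auto
  finally have "(\<integral>\<^sup>+x. liminf (\<lambda>n. ennreal (f n x)) \<partial>M) \<noteq> \<infinity>"
    by (auto simp: top_unique)
  then have "AE x in M. liminf (\<lambda>n. ennreal (f n x)) \<noteq> \<infinity>"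
    by (intro nn_integral_PInf_AE) auto
  then show ?thesis
  proof eventually_elim
    case (elim x)
    show ?case
    proof
      assume "filterlim (\<lambda>n. f n x) at_top sequentially"
      then have "(\<lambda>n. ennreal (f n x)) \<longlonglongrightarrow> top"
        by (rule ennreal_tendsto_top_eq_at_top[THEN iffD2])
      then show False using elim by (auto dest: lim_imp_Liminf[rotated])
    qed
  qed
qed

text \<open>The functional \<open>S f = \<integral> \<Sum>\<^sub>j exp (- f\<^sub>j)\<close> is so strictly convex that any two of its
  almost minimisers over a convex set are close to each other: the defect of convexity at the midpoint
  is exactly the squared \<open>L\<^sup>2\<close> distance of the functions \<open>exp (- f\<^sub>j / 2)\<close>. Choosing \<open>F n\<close> as an
  almost minimiser over \<open>C n\<close> therefore gives a Cauchy sequence, because the infima increase to a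
  finite limit. The functions themselves may tend to \<open>\<infinity>\<close>, which is why the conclusion is about their
  exponentials.\<close>

lemma (in finite_measure) nested_convex_AE_convergent:
  fixes C :: "nat \<Rightarrow> ('i \<Rightarrow> 'a \<Rightarrow> real) set"
  assumes "finite I" and dec: "decseq C" and ne: "\<And>n. C n \<noteq> {}"
    and meas: "\<And>n f j. f \<in> C n \<Longrightarrow> j \<in> I \<Longrightarrow> f j \<in> borel_measurable M"
    and nonneg: "\<And>n f j x. f \<in> C n \<Longrightarrow> j \<in> I \<Longrightarrow> 0 \<le> f j x"
    and midpoint: "\<And>n f g. f \<in> C n \<Longrightarrow> g \<in> C n \<Longrightarrow> (\<lambda>j x. (f j x + g j x) / 2) \<in> C n"
  obtains F where "\<And>n. F n \<in> C n" "\<And>j. j \<in> I \<Longrightarrow> AE x in M. convergent (\<lambda>n. exp (- F n j x / 2))"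
proof -
  have int_bdd: "integrable M v" if "v \<in> borel_measurable M" "\<And>x. 0 \<le> v x" "\<And>x. v x \<le> 1" for v :: "'a \<Rightarrow> real"
    by (rule integrable_const_bound[of _ 1]) (use that in auto)
  have int_exp: "integrable M (\<lambda>x. exp (- f j x))" if "f \<in> C n" "j \<in> I" for f n j
    using meas[OF that] nonneg[OF that] by (intro int_bdd) auto
  define S :: "('i \<Rightarrow> 'a \<Rightarrow> real) \<Rightarrow> real" where "S f = (\<integral>x. (\<Sum>j\<in>I. exp (- f j x)) \<partial>M)" for f
  have S0: "0 \<le> S f" for f
    unfolding S_def by (intro integral_nonneg_AE AE_I2 sum_nonneg) auto
  have bdd: "bdd_below (S ` C n)" for n
    using S0 by (intro bdd_belowI[of _ 0]) auto
  define J where "J n = Inf (S ` C n)" for n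
  have J_le: "J n \<le> S f" if "f \<in> C n" for f n
    unfolding J_def using that bdd by (intro cInf_lower) auto
  have "incseq J"
    unfolding J_def incseq_def
    using dec bdd ne by (auto intro!: cInf_superset_mono image_mono simp: decseq_def)
  moreover have "J n \<le> real (card I) * measure M (space M)" for n
  proof -
    obtain f where f: "f \<in> C n" using ne by auto
    have "S f \<le> (\<integral>x. real (card I) \<partial>M)"
      unfolding S_def
      using f int_exp nonneg
      by (intro integral_mono Bochner_Integration.integrable_sum)
        (auto intro!: sum_bounded_above[where K=1, simplified])
    with J_le[OF f] show ?thesis by (simp add: mult.commute)
  qed
  ultimately have "Cauchy J"
    using incseq_convergent[of J] by (metis LIMSEQ_imp_Cauchy)
  have "\<exists>f\<in>C n. S f < J n + 1 / real (Suc n)" for n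
    using cInf_lessD[of "S ` C n" "J n + 1 / real (Suc n)"] ne[of n] by (auto simp: J_def)
  then obtain F where F: "\<And>n. F n \<in> C n" "\<And>n. S (F n) < J n + 1 / real (Suc n)"
    by metis
  define V where "V j n x = exp (- F n j x / 2)" for j n x
  have V_meas [measurable]: "V j n \<in> borel_measurable M" if "j \<in> I" for j n
    using meas[OF F(1) that] unfolding V_def by measurable
  have V01: "0 \<le> V j n x" "V j n x \<le> 1" if "j \<in> I" for j n x
    using nonneg[OF F(1) that, of n x] by (auto simp: V_def)
  have V_int: "integrable M (V j n)" if "j \<in> I" for j n
    by (rule int_bdd) (use that V01 in auto)
  have V_diff_int: "integrable M (\<lambda>x. (V j m x - V j n x)\<^sup>2)" if "j \<in> I" for j m n
  proof (rule int_bdd)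
    show "(V j m x - V j n x)\<^sup>2 \<le> 1" for x
      using V01[OF that, of m x] V01[OF that, of n x] by (simp add: abs_square_le_1)
  qed (use that in auto)
  \<comment> \<open>By \<open>(exp (-a/2) - exp (-b/2))\<^sup>2 = exp (-a) + exp (-b) - 2 * exp (-(a+b)/2)\<close>, the midpoint
    \<open>h\<close>, which cannot have a value of \<open>S\<close> below the infimum, bounds the \<open>L\<^sup>2\<close> distance.\<close>
  have L2: "(\<integral>x. (V j m x - V j n x)\<^sup>2 \<partial>M) \<le> (J n - J m) + 2 / real (Suc m)"
    if j: "j \<in> I" and mn: "m \<le> n" for j m n
  proof -
    define h where "h = (\<lambda>j x. (F m j x + F n j x) / 2)"
    have Fn: "F n \<in> C m" using F(1)[of n] dec mn by (auto simp: decseq_def)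
    then have h: "h \<in> C m" unfolding h_def by (intro midpoint F)
    have "(\<integral>x. (V j m x - V j n x)\<^sup>2 \<partial>M) \<le> (\<integral>x. (\<Sum>j\<in>I. (V j m x - V j n x)\<^sup>2) \<partial>M)"
      using j \<open>finite I\<close>
      by (intro integral_mono Bochner_Integration.integrable_sum V_diff_int member_le_sum) auto
    also have "\<dots> = (\<integral>x. (\<Sum>j\<in>I. exp (- F m j x)) + (\<Sum>j\<in>I. exp (- F n j x)) - 2 * (\<Sum>j\<in>I. exp (- h j x)) \<partial>M)"
      unfolding sum_distrib_left sum.distrib[symmetric] sum_subtractf[symmetric]
      by (intro Bochner_Integration.integral_cong refl sum.cong)
        (auto simp: V_def h_def power2_eq_square algebra_simps exp_add[symmetric] add_divide_distrib)
    also have "\<dots> = S (F m) + S (F n) - 2 * S h"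
      unfolding S_def using int_exp[OF h] int_exp[OF F(1)] by simp
    also have "\<dots> \<le> (J m + 1 / real (Suc m)) + (J n + 1 / real (Suc n)) - 2 * J m"
      using F(2)[of m] F(2)[of n] J_le[OF h] by linarith
    also have "\<dots> \<le> (J n - J m) + 2 / real (Suc m)"
    proof -
      have "1 / real (Suc n) \<le> 1 / real (Suc m)" using mn by (intro divide_left_mono) auto
      then show ?thesis by linarith
    qed
    finally show ?thesis .
  qed
  have L1: "\<exists>N. \<forall>m\<ge>N. \<forall>n\<ge>N. (\<integral>x. norm (V j m x - V j n x) \<partial>M) < e" if j: "j \<in> I" and e: "0 < e" for j e
  proof -
    define \<eta> where "\<eta> = (e / 2) / (measure M (space M) + 1)"
    have \<eta>: "0 < \<eta>" using e by (auto simp: \<eta>_def intro!: divide_pos_pos add_nonneg_pos)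
    have \<eta>M: "\<eta> * measure M (space M) \<le> e / 2"
    proof -
      have "\<eta> * measure M (space M) \<le> \<eta> * (measure M (space M) + 1)"
        using \<eta> by (intro mult_left_mono) auto
      also have "\<dots> = e / 2"
        using measure_nonneg[of M "space M"] unfolding \<eta>_def by (intro nonzero_eq_divide_eq[THEN iffD1, OF _ refl]) linarith
      finally show ?thesis .
    qed
    define \<kappa> where "\<kappa> = \<eta> * (e / 2)"
    have \<kappa>: "0 < \<kappa>" using \<eta> e by (simp add: \<kappa>_def)
    obtain N1 where N1: "\<And>m n. m \<ge> N1 \<Longrightarrow> n \<ge> N1 \<Longrightarrow> \<bar>J m - J n\<bar> < \<kappa> / 2"
      using \<open>Cauchy J\<close> \<kappa> unfolding Cauchy_def dist_real_def by (metis half_gt_zero)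
    obtain N2 where N2: "4 / \<kappa> < real N2" using reals_Archimedean2 by blast
    have est: "(\<integral>x. norm (V j m x - V j n x) \<partial>M) < e" if "max N1 N2 \<le> m" "m \<le> n" for m n
    proof -
      have "2 / real (Suc m) < \<kappa> / 2"
      proof -
        have "4 / \<kappa> < real (Suc m)" using N2 that by linarith
        then show ?thesis using \<kappa> by (simp add: field_simps)
      qed
      then have D: "(\<integral>x. (V j m x - V j n x)\<^sup>2 \<partial>M) < \<kappa>"
        using L2[OF j \<open>m \<le> n\<close>] N1[of n m] that by linarith
      \<comment> \<open>On a finite measure space this passes from \<open>L\<^sup>2\<close> to \<open>L\<^sup>1\<close>.\<close>
      have *: "norm (a::real) \<le> \<eta> + a\<^sup>2 / \<eta>" for a
      proof -
        have "\<bar>a\<bar> * \<eta> \<le> \<eta>\<^sup>2 + \<bar>a\<bar>\<^sup>2"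
          using sum_squares_bound[of "\<bar>a\<bar>" \<eta>] \<eta> mult_nonneg_nonneg[of "\<bar>a\<bar>" \<eta>] by linarith
        then show ?thesis using \<eta> by (simp add: field_simps power2_eq_square)
      qed
      have "(\<integral>x. norm (V j m x - V j n x) \<partial>M) \<le> (\<integral>x. \<eta> + (V j m x - V j n x)\<^sup>2 / \<eta> \<partial>M)"
        using V_int[OF j] V_diff_int[OF j] * by (intro integral_mono) auto
      also have "\<dots> = \<eta> * measure M (space M) + (\<integral>x. (V j m x - V j n x)\<^sup>2 \<partial>M) / \<eta>"
        using V_diff_int[OF j] by (simp add: mult.commute)
      also have "\<dots> < e / 2 + \<kappa> / \<eta>"
        using D \<eta> \<eta>M by (intro add_le_less_mono divide_strict_right_mono) auto
      also have "\<dots> = e" using \<eta> by (simp add: \<kappa>_def)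
      finally show ?thesis .
    qed
    show ?thesis
    proof (intro exI allI impI)
      fix m n assume "max N1 N2 \<le> m" "max N1 N2 \<le> n"
      then show "(\<integral>x. norm (V j m x - V j n x) \<partial>M) < e"
        using est[of m n] est[of n m] by (cases "m \<le> n") (auto simp: abs_minus_commute)
    qed
  qed
  obtain r where r: "strict_mono r" "\<And>j. j \<in> I \<Longrightarrow> AE x in M. Cauchy (\<lambda>n. V j (r n) x)"
    using common_AE_Cauchy_subseq[where s=V, OF \<open>finite I\<close> V_int L1] by blast
  show ?thesis
  proof
    show "F (r n) \<in> C n" for n
      using F(1)[of "r n"] dec seq_suble[OF r(1), of n] by (auto simp: decseq_def)
    show "AE x in M. convergent (\<lambda>n. exp (- F (r n) j x / 2))" if "j \<in> I" for j
      using r(2)[OF that] by (simp add: V_def Cauchy_convergent_iff)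
  qed
qed

section \<open>Exhaustion by a saturating convex family\<close>

text \<open>Exhaustion. The positivity set of a midpoint is the union of the two positivity sets. So there
  is an increasing sequence of positivity sets whose measures tend to the supremum of all such
  measures; if its union missed a set of positive measure, saturation would provide a function whose
  midpoint with a late member exceeds that supremum.\<close>

lemma (in finite_measure) convex_saturating_almost_positive:
  fixes K :: "('a \<Rightarrow> real) set"
  assumes ne: "K \<noteq> {}"
    and meas: "\<And>u. u \<in> K \<Longrightarrow> u \<in> borel_measurable M"
    and nonneg: "\<And>u x. u \<in> K \<Longrightarrow> 0 \<le> u x"
    and midpoint: "\<And>u v. u \<in> K \<Longrightarrow> v \<in> K \<Longrightarrow> (\<lambda>x. (u x + v x) / 2) \<in> K"
    and saturating: "\<And>E. E \<in> sets M \<Longrightarrow> 0 < emeasure M E \<Longrightarrow>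
      \<exists>E'\<in>sets M. E' \<subseteq> E \<and> 0 < emeasure M E' \<and> (\<exists>h\<in>K. AE x in M. x \<in> E' \<longrightarrow> 0 < h x)"
  obtains k where "\<And>n. k n \<in> K" "AE x in M. \<exists>n. 0 < k n x"
    "(\<lambda>n. measure M {x \<in> space M. k n x \<le> 0}) \<longlonglongrightarrow> 0"
proof -
  define S where "S u = {x \<in> space M. 0 < u x}" for u :: "'a \<Rightarrow> real"
  have S_sets [measurable]: "S u \<in> sets M" if "u \<in> K" for u
    unfolding S_def using meas[OF that] by measurable
  define s where "s = Sup ((\<lambda>u. measure M (S u)) ` K)"
  have s_ge: "measure M (S u) \<le> s" if "u \<in> K" for u
    unfolding s_def using that
    by (intro cSup_upper) (auto intro!: bdd_aboveI[of _ "measure M (space M)"] bounded_measure)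
  have S_mid: "S (\<lambda>x. (u x + v x) / 2) = S u \<union> S v" if "u \<in> K" "v \<in> K" for u v
    using nonneg[OF that(1)] nonneg[OF that(2)] unfolding S_def
    by (auto simp: add_pos_nonneg add_nonneg_pos)
  have "\<exists>u\<in>K. s - 1 / real (Suc n) < measure M (S u)" for n
    using less_cSupD[of "(\<lambda>u. measure M (S u)) ` K" "s - 1 / real (Suc n)"] ne
    by (auto simp: s_def)
  then obtain u where u: "\<And>n. u n \<in> K" "\<And>n. s - 1 / real (Suc n) < measure M (S (u n))" by metis
  define k where "k = rec_nat (u 0) (\<lambda>n w x. (w x + u (Suc n) x) / 2)"
  have k_Suc: "k (Suc n) = (\<lambda>x. (k n x + u (Suc n) x) / 2)" for n by (simp add: k_def)
  have kK: "k n \<in> K" for n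
    by (induction n) (auto simp: k_Suc intro!: midpoint u, simp add: k_def u)
  have Sk_Suc: "S (k (Suc n)) = S (k n) \<union> S (u (Suc n))" for n
    unfolding k_Suc by (rule S_mid[OF kK u(1)])
  have inc: "incseq (\<lambda>n. S (k n))"
    by (rule incseq_SucI) (simp add: Sk_Suc)
  have "S (u n) \<subseteq> S (k n)" for n
    by (cases n) (auto simp: Sk_Suc, simp add: k_def)
  then have k_gt: "s - 1 / real (Suc n) < measure M (S (k n))" for n
    using u(2)[of n] finite_measure_mono[of "S (u n)" "S (k n)"] S_sets[OF kK] by fastforce
  define E where "E = space M - (\<Union>n. S (k n))"
  have E [measurable]: "E \<in> sets M" unfolding E_def using S_sets[OF kK] by measurable
  have "emeasure M E = 0"
  proof (rule ccontr)
    assume "emeasure M E \<noteq> 0"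
    then obtain E' h where E': "E' \<in> sets M" "E' \<subseteq> E" "0 < emeasure M E'"
      and h: "h \<in> K" "AE x in M. x \<in> E' \<longrightarrow> 0 < h x"
      using saturating[OF E] by (auto simp: zero_less_iff_neq_zero)
    have E'pos: "0 < measure M E'" using E'(3) by (simp add: emeasure_eq_measure)
    obtain n where n: "1 / real (Suc n) < measure M E'"
      using E'pos by (metis nat_approx_posE)
    have "measure M (S (k n)) + measure M E' = measure M (S (k n) \<union> E')"
      using E' S_sets[OF kK] by (intro finite_measure_Union[symmetric]) (auto simp: E_def)
    also have "\<dots> \<le> measure M (S (\<lambda>x. (k n x + h x) / 2))"
    proof (rule finite_measure_mono_AE)
      show "AE x in M. x \<in> S (k n) \<union> E' \<longrightarrow> x \<in> S (\<lambda>x. (k n x + h x) / 2)"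
        using h(2) AE_space unfolding S_mid[OF kK h(1)]
        by eventually_elim (auto simp: S_def)
    qed (rule S_sets[OF midpoint[OF kK h(1)]])
    also have "\<dots> \<le> s" by (rule s_ge[OF midpoint[OF kK h(1)]])
    finally show False using k_gt[of n] n by linarith
  qed
  then have null: "E \<in> null_sets M" using E by auto
  show ?thesis
  proof (rule that[OF kK])
    show "AE x in M. \<exists>n. 0 < k n x"
      using AE_not_in[OF null] AE_space by eventually_elim (auto simp: E_def S_def)
    have "(\<lambda>n. measure M (S (k n))) \<longlonglongrightarrow> measure M (\<Union>n. S (k n))"
      using S_sets[OF kK] by (intro finite_Lim_measure_incseq inc) auto
    also have "measure M (\<Union>n. S (k n)) = measure M (space M)"
    proof -
      have "measure M (space M) - measure M (\<Union>n. S (k n)) = measure M E"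
        unfolding E_def using S_sets[OF kK] by (intro finite_measure_compl[symmetric]) auto
      then show ?thesis using null by (simp add: null_sets_def measure_def)
    qed
    finally have "(\<lambda>n. measure M (space M) - measure M (S (k n))) \<longlonglongrightarrow> measure M (space M) - measure M (space M)"
      by (intro tendsto_intros)
    moreover have "measure M {x \<in> space M. k n x \<le> 0} = measure M (space M) - measure M (S (k n))" for n
    proof -
      have "{x \<in> space M. k n x \<le> 0} = space M - S (k n)" by (auto simp: S_def)
      then show ?thesis using S_sets[OF kK] by (simp add: finite_measure_compl)
    qed
    ultimately show "(\<lambda>n. measure M {x \<in> space M. k n x \<le> 0}) \<longlonglongrightarrow> 0" by simp
  qed
qed

section \<open>Weighted geometric means\<close>

locale convex_weights =
  fixes I :: "'i set" and \<alpha> :: "'i \<Rightarrow> real"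
  assumes finite_index: "finite I"
    and weight_pos: "\<And>j. j \<in> I \<Longrightarrow> 0 < \<alpha> j"
    and sum_weights: "(\<Sum>j\<in>I. \<alpha> j) = 1"
begin

definition gmean :: "('i \<Rightarrow> real) \<Rightarrow> real" where
  "gmean u = (\<Prod>j\<in>I. u j powr \<alpha> j)"

lemma gmean_nonneg: "0 \<le> gmean u"
  by (simp add: gmean_def prod_nonneg)

lemma gmean_pos: "(\<And>j. j \<in> I \<Longrightarrow> 0 < u j) \<Longrightarrow> 0 < gmean u"
  unfolding gmean_def by (intro prod_pos) (metis powr_gt_zero less_irrefl)

lemma gmean_cong: "(\<And>j. j \<in> I \<Longrightarrow> u j = v j) \<Longrightarrow> gmean u = gmean v"
  by (simp add: gmean_def cong: prod.cong)

lemma gmean_mono: "(\<And>j. j \<in> I \<Longrightarrow> 0 \<le> u j \<and> u j \<le> v j) \<Longrightarrow> gmean u \<le> gmean v"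
  unfolding gmean_def
  by (intro prod_mono conjI powr_mono2) (use weight_pos in \<open>auto simp: less_imp_le\<close>)

lemma gmean_eq_0: "j \<in> I \<Longrightarrow> u j = 0 \<Longrightarrow> gmean u = 0"
  unfolding gmean_def by (subst prod_zero_iff[OF finite_index]) auto

lemma gmean_mult:
  "(\<And>j. j \<in> I \<Longrightarrow> 0 \<le> u j) \<Longrightarrow> (\<And>j. j \<in> I \<Longrightarrow> 0 \<le> v j) \<Longrightarrow>
    gmean (\<lambda>j. u j * v j) = gmean u * gmean v"
  by (simp add: gmean_def powr_mult prod.distrib[symmetric] cong: prod.cong)

lemma gmean_const: "0 < c \<Longrightarrow> gmean (\<lambda>_. c) = c"
  by (simp add: gmean_def powr_sum[symmetric] finite_index sum_weights)

lemma gmean_scale: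
  assumes "0 < c" "\<And>j. j \<in> I \<Longrightarrow> 0 \<le> u j"
  shows "gmean (\<lambda>j. c * u j) = c * gmean u"
  using gmean_mult[of "\<lambda>_. c" u] gmean_const[of c] assms by simp

lemma gmean_upd:
  assumes "j \<in> I"
  shows "gmean (u(j := c)) = c powr \<alpha> j * (\<Prod>i\<in>I - {j}. u i powr \<alpha> i)"
  unfolding gmean_def using assms
  by (subst prod.remove[OF finite_index assms]) (auto intro!: prod.cong)

text \<open>The weighted inequality between geometric and arithmetic means, from convexity of \<open>exp\<close>.\<close>

lemma gmean_le_weighted_sum:
  assumes "\<And>j. j \<in> I \<Longrightarrow> 0 \<le> t j"
  shows "gmean t \<le> (\<Sum>j\<in>I. \<alpha> j * t j)"
proof (cases "\<exists>j\<in>I. t j = 0")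
  case True
  then have "gmean t = 0" using gmean_eq_0 by auto
  also have "0 \<le> (\<Sum>j\<in>I. \<alpha> j * t j)"
    using assms weight_pos by (intro sum_nonneg mult_nonneg_nonneg) (auto simp: less_imp_le)
  finally show ?thesis .
next
  case False
  then have pos: "0 < t j" if "j \<in> I" for j
    using assms[OF that] that by (auto simp: less_le)
  have "gmean t = exp (\<Sum>j\<in>I. \<alpha> j *\<^sub>R ln (t j))"
    unfolding gmean_def exp_sum[OF finite_index]
    by (intro prod.cong refl) (use pos in \<open>auto simp: powr_def less_imp_neq[THEN not_sym]\<close>)
  also have "\<dots> \<le> (\<Sum>j\<in>I. \<alpha> j * exp (ln (t j)))"
    by (rule convex_on_sum[OF finite_index _ exp_convex])
      (use sum_weights weight_pos in \<open>auto simp: less_imp_le\<close>)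
  also have "\<dots> = (\<Sum>j\<in>I. \<alpha> j * t j)"
    using pos by (intro sum.cong) auto
  finally show ?thesis .
qed

text \<open>The right-hand side is the tangent functional of the geometric mean at \<open>u\<close>. Concavity follows,
  since the bounds for two points at their convex combination add up to the value there.\<close>

lemma gmean_le_tangent:
  assumes v: "\<And>j. j \<in> I \<Longrightarrow> 0 \<le> v j" and u: "\<And>j. j \<in> I \<Longrightarrow> 0 < u j"
  shows "gmean v \<le> gmean u * (\<Sum>j\<in>I. \<alpha> j * (v j / u j))"
proof -
  have "gmean v = gmean (\<lambda>j. u j * (v j / u j))"
    using u by (intro gmean_cong) (simp add: less_imp_neq[THEN not_sym])
  also have "\<dots> = gmean u * gmean (\<lambda>j. v j / u j)"
    using u v by (intro gmean_mult) (auto simp: less_imp_le)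
  also have "\<dots> \<le> gmean u * (\<Sum>j\<in>I. \<alpha> j * (v j / u j))"
    using u v by (intro mult_left_mono gmean_le_weighted_sum gmean_nonneg) (auto simp: less_imp_le)
  finally show ?thesis .
qed

lemma gmean_concave:
  assumes u: "\<And>j. j \<in> I \<Longrightarrow> 0 \<le> u j" and v: "\<And>j. j \<in> I \<Longrightarrow> 0 \<le> v j"
    and s: "0 \<le> s" "s \<le> (1::real)"
  shows "(1 - s) * gmean u + s * gmean v \<le> gmean (\<lambda>j. (1 - s) * u j + s * v j)"
proof (cases "s = 0 \<or> s = 1")
  case True
  then show ?thesis by auto
next
  case False
  with s have s: "0 < s" "s < 1" by auto
  define w where "w j = (1 - s) * u j + s * v j" for j
  have w0: "0 \<le> w j" if "j \<in> I" for j
    using u[OF that] v[OF that] s by (simp add: w_def)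
  show ?thesis
  proof (cases "\<exists>j\<in>I. w j = 0")
    case True
    then obtain j where j: "j \<in> I" "w j = 0" by auto
    have "0 \<le> (1 - s) * u j" "0 \<le> s * v j"
      using u[OF j(1)] v[OF j(1)] s by auto
    with j(2) have "(1 - s) * u j = 0" "s * v j = 0"
      unfolding w_def by linarith+
    then have "u j = 0" "v j = 0" using s by auto
    then have "gmean u = 0" "gmean v = 0" using j(1) gmean_eq_0 by auto
    then show ?thesis by (simp add: gmean_nonneg)
  next
    case False
    then have w: "0 < w j" if "j \<in> I" for j
      using w0[OF that] that by (auto simp: less_le)
    have "(1 - s) * gmean u + s * gmean v
        \<le> (1 - s) * (gmean w * (\<Sum>j\<in>I. \<alpha> j * (u j / w j))) + s * (gmean w * (\<Sum>j\<in>I. \<alpha> j * (v j / w j)))"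
      using s u v w by (intro add_mono mult_left_mono gmean_le_tangent) auto
    also have "\<dots> = gmean w * (\<Sum>j\<in>I. (1 - s) * (\<alpha> j * (u j / w j)) + s * (\<alpha> j * (v j / w j)))"
      by (simp add: sum_distrib_left sum.distrib algebra_simps)
    also have "(\<Sum>j\<in>I. (1 - s) * (\<alpha> j * (u j / w j)) + s * (\<alpha> j * (v j / w j))) = (\<Sum>j\<in>I. \<alpha> j)"
    proof (intro sum.cong refl)
      fix j assume "j \<in> I"
      have "(1 - s) * (\<alpha> j * (u j / w j)) + s * (\<alpha> j * (v j / w j)) 
          = \<alpha> j * (((1 - s) * u j + s * v j) / w j)"
        by (simp only: add_divide_distrib distrib_left times_divide_eq_right mult.left_commute)
      also have "\<dots> = \<alpha> j" using w[OF \<open>j \<in> I\<close>] by (simp add: w_def[symmetric])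
      finally show "(1 - s) * (\<alpha> j * (u j / w j)) + s * (\<alpha> j * (v j / w j)) = \<alpha> j" .
    qed
    finally show ?thesis by (simp add: sum_weights w_def[abs_def])
  qed
qed

lemma tendsto_gmean:
  assumes "\<And>j. j \<in> I \<Longrightarrow> ((\<lambda>n. u n j) \<longlongrightarrow> v j) F" "\<And>j n. j \<in> I \<Longrightarrow> 0 \<le> u n j"
  shows "((\<lambda>n. gmean (u n)) \<longlongrightarrow> gmean v) F"
  unfolding gmean_def
  by (intro tendsto_prod tendsto_powr2 tendsto_const) (use assms weight_pos in auto)

lemma borel_measurable_gmean [measurable (raw)]:
  assumes "\<And>j. j \<in> I \<Longrightarrow> u j \<in> borel_measurable M"
  shows "(\<lambda>x. gmean (\<lambda>j. u j x)) \<in> borel_measurable M"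
  unfolding gmean_def using assms by measurable

text \<open>A sequence with a positive lower bound in each coordinate cannot have bounded geometric means
  while one of its coordinates escapes to infinity.\<close>

lemma gmean_at_top:
  assumes j: "j \<in> I" and lim: "filterlim (\<lambda>n. f n j) at_top F"
    and c: "\<And>i. i \<in> I \<Longrightarrow> 0 < c i" and le: "\<And>n i. i \<in> I \<Longrightarrow> c i \<le> f n i"
  shows "filterlim (\<lambda>n. gmean (f n)) at_top F"
proof -
  define P where "P = (\<Prod>i\<in>I - {j}. c i powr \<alpha> i)"
  have "0 < c i powr \<alpha> i" if "i \<in> I - {j}" for i using c[of i] that by simp
  then have P: "0 < P" unfolding P_def by (intro prod_pos) auto
  have "filterlim (\<lambda>n. \<alpha> j * ln (f n j)) at_top F"
    by (intro filterlim_tendsto_pos_mult_at_top[OF tendsto_const weight_pos[OF j]]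
        filterlim_compose[OF ln_at_top lim])
  then have "filterlim (\<lambda>n. exp (\<alpha> j * ln (f n j)) * P) at_top F"
    by (intro filterlim_at_top_mult_tendsto_pos[OF tendsto_const P] filterlim_compose[OF exp_at_top])
  then show ?thesis
  proof (rule filterlim_at_top_mono, intro always_eventually allI)
    fix n
    have "exp (\<alpha> j * ln (f n j)) * P = gmean (c(j := f n j))"
      using c[OF j] le[OF j, of n] by (simp add: gmean_upd[OF j] P_def powr_def)
    also have "\<dots> \<le> gmean (f n)"
    proof (rule gmean_mono)
      fix i assume i: "i \<in> I"
      show "0 \<le> (c(j := f n j)) i \<and> (c(j := f n j)) i \<le> f n i"
        using c[OF i] le[OF i, of n] by auto
    qed
    finally show "exp (\<alpha> j * ln (f n j)) * P \<le> gmean (f n)" .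
  qed
qed

section \<open>The first-order condition at a maximiser\<close>

lemma weight_le_1: "j \<in> I \<Longrightarrow> \<alpha> j \<le> 1"
  using member_le_sum[of j I \<alpha>] finite_index weight_pos sum_weights by (auto simp: less_imp_le)

lemma exp_gmean_convex:
  assumes u: "\<And>i. i \<in> I \<Longrightarrow> 0 \<le> u i" and v: "\<And>i. i \<in> I \<Longrightarrow> 0 \<le> v i"
    and t: "0 \<le> t" "t \<le> 1" and e: "0 \<le> \<epsilon>"
  shows "exp (- \<epsilon> * gmean (\<lambda>i. (1 - t) * u i + t * v i))
    \<le> (1 - t) * exp (- \<epsilon> * gmean u) + t * exp (- \<epsilon> * gmean v)"
proof -
  have "- \<epsilon> * gmean (\<lambda>i. (1 - t) * u i + t * v i) \<le> - \<epsilon> * ((1 - t) * gmean u + t * gmean v)"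
    using e gmean_concave[OF u v t] by (intro mult_left_mono_neg) auto
  then have "exp (- \<epsilon> * gmean (\<lambda>i. (1 - t) * u i + t * v i))
      \<le> exp ((1 - t) *\<^sub>R (- \<epsilon> * gmean u) + t *\<^sub>R (- \<epsilon> * gmean v))"
    by (simp add: algebra_simps)
  also have "\<dots> \<le> (1 - t) * exp (- \<epsilon> * gmean u) + t * exp (- \<epsilon> * gmean v)"
    by (rule convex_onD[OF exp_convex]) (use t in auto)
  finally show ?thesis .
qed

lemma exp_gmean_segment:
  assumes u: "\<And>i. i \<in> I \<Longrightarrow> 0 \<le> u i" and b: "0 \<le> b" and t: "0 \<le> t" "t \<le> 1"
    and e: "0 \<le> \<epsilon>"
  shows "exp (- \<epsilon> * gmean (u(j := (1 - t) * u j + t * b)))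
    \<le> (1 - t) * exp (- \<epsilon> * gmean u) + t * exp (- \<epsilon> * gmean (u(j := b)))"
proof -
  have "gmean (u(j := (1 - t) * u j + t * b)) = gmean (\<lambda>i. (1 - t) * u i + t * (u(j := b)) i)"
    by (intro gmean_cong) (auto simp: algebra_simps)
  then show ?thesis
    using exp_gmean_convex[of u "u(j := b)" t \<epsilon>] u b t e by simp
qed

text \<open>One-sided derivative in the direction from \<open>u j\<close> to \<open>b\<close>. It is written as a difference of two
  nonnegative terms, which are integrated separately later.\<close>

lemma exp_gmean_difference_quotient:
  assumes j: "j \<in> I" and uj: "0 < u j"
  shows "(\<lambda>n. (exp (- \<epsilon> * gmean u)
       - exp (- \<epsilon> * gmean (u(j := (1 - 1 / real (Suc n)) * u j + 1 / real (Suc n) * b)))) / (1 / real (Suc n)))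
    \<longlonglongrightarrow> \<epsilon> * \<alpha> j * (exp (- \<epsilon> * gmean u) * gmean u / u j * b) - \<epsilon> * \<alpha> j * (exp (- \<epsilon> * gmean u) * gmean u)"
proof -
  define P where "P = (\<Prod>i\<in>I - {j}. u i powr \<alpha> i)"
  define E where "E t = exp (- \<epsilon> * (((1 - t) * u j + t * b) powr \<alpha> j * P))" for t
  have E_eq: "exp (- \<epsilon> * gmean (u(j := (1 - t) * u j + t * b))) = E t" for t
    by (simp add: E_def P_def gmean_upd[OF j])
  have gm: "gmean u = u j powr \<alpha> j * P"
    using gmean_upd[OF j, of u "u j"] by (simp add: P_def)
  have "(E has_real_derivative - \<epsilon> * (\<alpha> j * u j powr (\<alpha> j - 1) * (b - u j) * P) * E 0) (at 0)"
    unfolding E_def using uj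
    by (auto intro!: derivative_eq_intros)
  then have "((\<lambda>h. (E (0 + h) - E 0) / h) \<longlongrightarrow> - \<epsilon> * (\<alpha> j * u j powr (\<alpha> j - 1) * (b - u j) * P) * E 0) (at 0)"
    by (rule DERIV_D)
  moreover have "filterlim (\<lambda>n. 1 / real (Suc n)) (at 0) sequentially"
    using LIMSEQ_inverse_real_of_nat by (auto simp: filterlim_at inverse_eq_divide)
  ultimately have "(\<lambda>n. (E (0 + 1 / real (Suc n)) - E 0) / (1 / real (Suc n)))
      \<longlonglongrightarrow> - \<epsilon> * (\<alpha> j * u j powr (\<alpha> j - 1) * (b - u j) * P) * E 0"
    by (rule filterlim_compose)
  from tendsto_minus[OF this]
  have lim: "(\<lambda>n. (E 0 - E (1 / real (Suc n))) / (1 / real (Suc n)))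
      \<longlonglongrightarrow> \<epsilon> * (\<alpha> j * u j powr (\<alpha> j - 1) * (b - u j) * P) * E 0"
    by (simp only: minus_divide_left minus_diff_eq add_0 mult_minus_left minus_minus)
  have E0: "E 0 = exp (- \<epsilon> * gmean u)"
    by (simp add: E_def gm)
  have "u j powr (\<alpha> j - 1) = u j powr \<alpha> j / u j"
    using uj by (simp add: powr_diff)
  then have val: "\<epsilon> * (\<alpha> j * u j powr (\<alpha> j - 1) * (b - u j) * P) * E 0 =
      \<epsilon> * \<alpha> j * (exp (- \<epsilon> * gmean u) * gmean u / u j * b) - \<epsilon> * \<alpha> j * (exp (- \<epsilon> * gmean u) * gmean u)"
    unfolding E0 using uj by (simp add: gm field_simps)
  show ?thesis
    using lim[unfolded val] unfolding E_eq E0 .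
qed

text \<open>Differentiation of the minimised functional at \<open>U\<close> in the direction of \<open>v\<close>, under the integral.
  By convexity the difference quotients are at least the difference quotient at \<open>t = 1\<close>, hence at
  least \<open>-1\<close>, so Fatou's lemma applies to them after adding \<open>1\<close>.\<close>

lemma first_order_condition:
  fixes U :: "'i \<Rightarrow> 'a \<Rightarrow> real"
  assumes "finite_measure M" and j: "j \<in> I" and \<epsilon>: "0 < \<epsilon>" and A: "0 \<le> A"
    and meas [measurable]: "\<And>i. i \<in> I \<Longrightarrow> U i \<in> borel_measurable M" and v [measurable]: "v \<in> borel_measurable M"
    and nonneg: "\<And>i x. 0 \<le> U i x" "\<And>x. 0 \<le> v x"
    and pos: "AE x in M. 0 < U j x"
    and bound: "(\<integral>\<^sup>+x. ennreal (gmean (\<lambda>i. U i x)) \<partial>M) \<le> ennreal A"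
    and minimal: "\<And>t. 0 \<le> t \<Longrightarrow> t \<le> 1 \<Longrightarrow>
      (\<integral>x. exp (- \<epsilon> * gmean (\<lambda>i. U i x)) \<partial>M)
        \<le> (\<integral>x. exp (- \<epsilon> * gmean ((\<lambda>i. U i x)(j := (1 - t) * U j x + t * v x))) \<partial>M)"
  shows "(\<integral>\<^sup>+x. ennreal (exp (- \<epsilon> * gmean (\<lambda>i. U i x)) * gmean (\<lambda>i. U i x) / U j x * v x) \<partial>M) \<le> ennreal A"
proof -
  interpret finite_measure M by fact
  define G where "G x = gmean (\<lambda>i. U i x)" for x
  define W where "W t x = exp (- \<epsilon> * gmean ((\<lambda>i. U i x)(j := (1 - t) * U j x + t * v x)))" for t x
  have [measurable]: "G \<in> borel_measurable M" unfolding G_def by measurable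
  have [measurable]: "W t \<in> borel_measurable M" for t
    unfolding W_def gmean_upd[OF j] using j by measurable
  note [measurable] = meas[OF j]
  have W01: "0 \<le> W t x" "W t x \<le> 1" for t x
    using \<epsilon> gmean_nonneg by (auto simp: W_def)
  have W_int: "integrable M (W t)" for t
    by (rule integrable_const_bound[of _ 1]) (use W01 in auto)
  have W0: "W 0 x = exp (- \<epsilon> * G x)" for x
    by (simp add: W_def G_def fun_upd_idem)
  define q where "q n x = (W 0 x - W (1 / real (Suc n)) x) / (1 / real (Suc n))" for n x
  have q_ge: "0 \<le> q n x + 1" for n x
  proof -
    define t where "t = 1 / real (Suc n)"
    have t: "0 < t" "t \<le> 1" by (auto simp: t_def)
    have "W t x \<le> (1 - t) * W 0 x + t * W 1 x"
      using exp_gmean_segment[of "\<lambda>i. U i x" "v x" t \<epsilon> j] nonneg t \<epsilon> by (simp add: W_def fun_upd_idem)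
    then have "t * (W 0 x - W 1 x) \<le> W 0 x - W t x" by (simp add: algebra_simps)
    then have "W 0 x - W 1 x \<le> (W 0 x - W t x) / t" using t by (simp add: field_simps)
    then have "W 0 x - W 1 x \<le> q n x" by (simp add: q_def t_def)
    then show ?thesis using W01[of 0 x] W01[of 1 x] by linarith
  qed
  have q_int: "(\<integral>\<^sup>+x. ennreal (q n x + 1) \<partial>M) \<le> emeasure M (space M)" for n
  proof -
    have "(\<integral>\<^sup>+x. ennreal (q n x + 1) \<partial>M) = ennreal (\<integral>x. q n x + 1 \<partial>M)"
      by (rule nn_integral_eq_integral) (use q_ge W_int in \<open>auto simp: q_def\<close>)
    also have "(\<integral>x. q n x + 1 \<partial>M) = ((\<integral>x. W 0 x \<partial>M) - (\<integral>x. W (1 / real (Suc n)) x \<partial>M)) / (1 / real (Suc n))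
        + measure M (space M)"
      unfolding q_def using W_int by simp
    also have "\<dots> \<le> measure M (space M)"
    proof -
      have "(\<integral>x. W 0 x \<partial>M) \<le> (\<integral>x. W (1 / real (Suc n)) x \<partial>M)"
        using minimal[of "1 / real (Suc n)"] by (simp add: W_def fun_upd_idem)
      then show ?thesis by (simp add: mult_nonpos_nonneg)
    qed
    finally show ?thesis by (simp add: emeasure_eq_measure ennreal_leI)
  qed
  \<comment> \<open>The limit of the difference quotients is \<open>\<epsilon> * \<alpha> j * R - Q\<close>; as \<open>s * exp (-s) \<le> 1\<close>, the term
    \<open>1 - Q\<close> is nonnegative and can be cancelled from both sides after integration.\<close>
  define Q where "Q x = \<epsilon> * \<alpha> j * (exp (- \<epsilon> * G x) * G x)" for x
  define R where "R x = exp (- \<epsilon> * G x) * G x / U j x * v x" for x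
  have [measurable]: "Q \<in> borel_measurable M" "R \<in> borel_measurable M"
    unfolding Q_def R_def by measurable
  have G0: "0 \<le> G x" for x by (simp add: G_def gmean_nonneg)
  have a: "0 < \<alpha> j" "\<alpha> j \<le> 1" using weight_pos weight_le_1 j by auto
  have R0: "0 \<le> R x" for x using G0 nonneg by (auto simp: R_def)
  have Q0: "0 \<le> Q x" for x using G0 a \<epsilon> by (simp add: Q_def)
  have Q1: "Q x \<le> 1" for x
  proof -
    have "\<epsilon> * G x \<le> exp (\<epsilon> * G x)" using exp_ge_add_one_self[of "\<epsilon> * G x"] by linarith
    then have "(\<epsilon> * G x) * exp (- (\<epsilon> * G x)) \<le> 1"
      by (simp add: exp_minus field_simps)
    then have "\<alpha> j * ((\<epsilon> * G x) * exp (- (\<epsilon> * G x))) \<le> 1 * 1"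
      using a G0 \<epsilon> by (intro mult_mono) auto
    then show ?thesis by (simp add: Q_def algebra_simps)
  qed
  have "AE x in M. (\<lambda>n. ennreal (q n x + 1)) \<longlonglongrightarrow> ennreal (\<epsilon> * \<alpha> j * R x) + ennreal (1 - Q x)"
    using pos
  proof eventually_elim
    case (elim x)
    have "(\<lambda>n. q n x + 1) \<longlonglongrightarrow> (\<epsilon> * \<alpha> j * R x - Q x) + 1"
      unfolding q_def W0 unfolding W_def R_def Q_def G_def
      by (intro tendsto_add tendsto_const exp_gmean_difference_quotient j elim)
    then have "(\<lambda>n. ennreal (q n x + 1)) \<longlonglongrightarrow> ennreal (\<epsilon> * \<alpha> j * R x + (1 - Q x))"
      by (intro tendsto_ennrealI) (simp add: algebra_simps)
    also have "ennreal (\<epsilon> * \<alpha> j * R x + (1 - Q x)) = ennreal (\<epsilon> * \<alpha> j * R x) + ennreal (1 - Q x)"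
      using R0 Q1 a \<epsilon> by (intro ennreal_plus) auto
    finally show ?case .
  qed
  then have "(\<integral>\<^sup>+x. ennreal (\<epsilon> * \<alpha> j * R x) + ennreal (1 - Q x) \<partial>M) \<le> emeasure M (space M)"
    by (rule nn_integral_le_if_AE_tendsto[OF _ _ q_int tendsto_const, rotated]) (unfold q_def, measurable)
  also have "\<dots> = (\<integral>\<^sup>+x. ennreal (Q x) + ennreal (1 - Q x) \<partial>M)"
  proof -
    have "ennreal (Q x) + ennreal (1 - Q x) = 1" for x
      using Q0 Q1 by (subst ennreal_plus[symmetric]) auto
    then show ?thesis by simp
  qed
  finally have "(\<integral>\<^sup>+x. ennreal (1 - Q x) \<partial>M) + (\<integral>\<^sup>+x. ennreal (\<epsilon> * \<alpha> j * R x) \<partial>M)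
      \<le> (\<integral>\<^sup>+x. ennreal (1 - Q x) \<partial>M) + (\<integral>\<^sup>+x. ennreal (Q x) \<partial>M)"
    by (subst (asm) (1 2) nn_integral_add) (auto simp: add.commute)
  moreover have "(\<integral>\<^sup>+x. ennreal (1 - Q x) \<partial>M) \<noteq> top"
  proof -
    have "(\<integral>\<^sup>+x. ennreal (1 - Q x) \<partial>M) \<le> (\<integral>\<^sup>+x. 1 \<partial>M)"
      by (intro nn_integral_mono) (use Q0 in \<open>auto simp: ennreal_le_1\<close>)
    then show ?thesis using emeasure_finite[of "space M"] by (auto simp: top_unique)
  qed
  ultimately have le: "(\<integral>\<^sup>+x. ennreal (\<epsilon> * \<alpha> j * R x) \<partial>M) \<le> (\<integral>\<^sup>+x. ennreal (Q x) \<partial>M)"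
    by (simp add: ennreal_add_left_cancel_le)
  have "ennreal (\<epsilon> * \<alpha> j) * (\<integral>\<^sup>+x. ennreal (R x) \<partial>M) = (\<integral>\<^sup>+x. ennreal (\<epsilon> * \<alpha> j * R x) \<partial>M)"
    using a \<epsilon> R0 by (subst nn_integral_cmult[symmetric]) (auto simp: ennreal_mult)
  also note le
  also have "(\<integral>\<^sup>+x. ennreal (Q x) \<partial>M) \<le> (\<integral>\<^sup>+x. ennreal (\<epsilon> * \<alpha> j) * ennreal (G x) \<partial>M)"
  proof (intro nn_integral_mono)
    fix x
    have "exp (- \<epsilon> * G x) * G x \<le> 1 * G x"
      using G0 \<epsilon> by (intro mult_right_mono) auto
    then have "Q x \<le> \<epsilon> * \<alpha> j * G x"
      unfolding Q_def using a \<epsilon> by (intro mult_left_mono) auto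
    then show "ennreal (Q x) \<le> ennreal (\<epsilon> * \<alpha> j) * ennreal (G x)"
      using a \<epsilon> G0 by (simp add: ennreal_mult[symmetric] ennreal_leI)
  qed
  also have "\<dots> = ennreal (\<epsilon> * \<alpha> j) * (\<integral>\<^sup>+x. ennreal (G x) \<partial>M)"
    by (rule nn_integral_cmult) auto
  also have "\<dots> \<le> ennreal (\<epsilon> * \<alpha> j) * ennreal A"
    using bound by (intro mult_left_mono) (auto simp: G_def)
  finally have "(\<integral>\<^sup>+x. ennreal (R x) \<partial>M) \<le> ennreal A"
    using a \<epsilon> by (subst (asm) ennreal_mult_le_mult_iff) (auto simp: ennreal_mult_eq_top_iff)
  then show ?thesis by (simp add: R_def G_def)
qed

end

section \<open>Maximisers over convex families\<close>

text \<open>The abstract setting: \<open>K j\<close> stands for the image of the nonnegative part of the unit ball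
  under the \<open>j\<close>-th operator, divided by the weight that makes the measure finite. The functions in \<open>K j\<close> are nonnegative at every point, which
  is a matter of choosing representatives.\<close>

locale convex_families = convex_weights I \<alpha> + finite_measure M
  for I :: "'i set" and \<alpha> :: "'i \<Rightarrow> real" and M :: "'a measure" +
  fixes K :: "'i \<Rightarrow> ('a \<Rightarrow> real) set" and A :: real
  assumes K_measurable: "\<And>j u. j \<in> I \<Longrightarrow> u \<in> K j \<Longrightarrow> u \<in> borel_measurable M"
    and K_nonneg: "\<And>j u x. j \<in> I \<Longrightarrow> u \<in> K j \<Longrightarrow> 0 \<le> u x"
    and K_convex: "\<And>j u v s. j \<in> I \<Longrightarrow> u \<in> K j \<Longrightarrow> v \<in> K j \<Longrightarrow> 0 \<le> s \<Longrightarrow> s \<le> 1 \<Longrightarrow>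
      (\<lambda>x. (1 - s) * u x + s * v x) \<in> K j"
    and gmean_bound: "\<And>u. (\<And>j. j \<in> I \<Longrightarrow> u j \<in> K j) \<Longrightarrow>
      (\<integral>\<^sup>+x. ennreal (gmean (\<lambda>j. u j x)) \<partial>M) \<le> ennreal A"
    and A_nonneg: "0 \<le> A"
begin

lemma K_midpoint: "j \<in> I \<Longrightarrow> u \<in> K j \<Longrightarrow> v \<in> K j \<Longrightarrow> (\<lambda>x. (u x + v x) / 2) \<in> K j"
  using K_convex[of j u v "1/2"] by (simp add: add_divide_distrib)

text \<open>A minimiser \<open>U\<close> of \<open>\<integral> exp (-\<epsilon> G(u))\<close>, obtained as an almost everywhere limit of elements of the
  families; it need not belong to them. As the integrand is bounded, dominated convergence shows
  that \<open>U\<close> realises the infimum, and that its convex combinations with elements of \<open>K j\<close> do not go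
  below it. The floor \<open>c\<close> serves twice: it keeps \<open>U\<close> positive, and it makes \<open>G\<close> unbounded along any
  sequence with an unbounded coordinate, so that the bound on \<open>\<integral> G\<close> makes \<open>U\<close> finite.\<close>

lemma exists_limit_minimizer:
  assumes \<epsilon>: "0 < \<epsilon>"
    and ne: "\<And>j. j \<in> I \<Longrightarrow> K j \<noteq> {}"
    and floor: "\<And>j u x. j \<in> I \<Longrightarrow> u \<in> K j \<Longrightarrow> c j x \<le> u x"
    and pos: "\<And>j. j \<in> I \<Longrightarrow> AE x in M. 0 < c j x"
  obtains U where "\<And>j. j \<in> I \<Longrightarrow> U j \<in> borel_measurable M" "\<And>j x. 0 \<le> U j x"
    "\<And>j. j \<in> I \<Longrightarrow> AE x in M. 0 < U j x"
    "(\<integral>\<^sup>+x. ennreal (gmean (\<lambda>j. U j x)) \<partial>M) \<le> ennreal A"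
    "\<And>j v t. j \<in> I \<Longrightarrow> v \<in> K j \<Longrightarrow> 0 \<le> t \<Longrightarrow> t \<le> 1 \<Longrightarrow>
      (\<integral>x. exp (- \<epsilon> * gmean (\<lambda>i. U i x)) \<partial>M)
        \<le> (\<integral>x. exp (- \<epsilon> * gmean ((\<lambda>i. U i x)(j := (1 - t) * U j x + t * v x))) \<partial>M)"
proof -
  define PK where "PK = {u. \<forall>j\<in>I. u j \<in> K j}"
  define J where "J u = (\<integral>x. exp (- \<epsilon> * gmean (\<lambda>i. u i x)) \<partial>M)" for u :: "'i \<Rightarrow> 'a \<Rightarrow> real"
  define m where "m = Inf (J ` PK)"
  define C where "C n = {u \<in> PK. J u \<le> m + 1 / real (Suc n)}" for n
  have exp01: "norm (exp (- \<epsilon> * gmean u)) \<le> 1" for u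
    using \<epsilon> gmean_nonneg by auto
  have J_int: "integrable M (\<lambda>x. exp (- \<epsilon> * gmean (\<lambda>i. u i x)))"
    if "\<And>i. i \<in> I \<Longrightarrow> u i \<in> borel_measurable M" for u
    using that exp01 by (intro integrable_const_bound[of _ 1] AE_I2) auto
  have J_lim: "(\<lambda>n. J (u n)) \<longlonglongrightarrow> J v"
    if "\<And>n i. i \<in> I \<Longrightarrow> u n i \<in> borel_measurable M" "\<And>i. i \<in> I \<Longrightarrow> v i \<in> borel_measurable M"
      "AE x in M. \<forall>i\<in>I. (\<lambda>n. u n i x) \<longlonglongrightarrow> v i x" "\<And>n i x. i \<in> I \<Longrightarrow> 0 \<le> u n i x" for u v
    unfolding J_def
  proof (rule integral_dominated_convergence[where w="\<lambda>_. 1"])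
    show "AE x in M. (\<lambda>n. exp (- \<epsilon> * gmean (\<lambda>i. u n i x))) \<longlonglongrightarrow> exp (- \<epsilon> * gmean (\<lambda>i. v i x))"
      using that(3) by eventually_elim (intro tendsto_intros tendsto_gmean, use that(4) in auto)
  qed (use that exp01 in auto)
  have J0: "0 \<le> J u" for u
    unfolding J_def by (intro integral_nonneg_AE AE_I2) simp
  have m_le: "m \<le> J u" if "u \<in> PK" for u
    unfolding m_def using that J0 by (intro cInf_lower bdd_belowI[of _ 0]) auto
  have "PK \<noteq> {}"
  proof -
    have "(\<lambda>j. SOME u. u \<in> K j) \<in> PK"
      unfolding PK_def using ne by (auto intro: some_in_eq[THEN iffD2])
    then show ?thesis by auto
  qed
  then have C_ne: "C n \<noteq> {}" for n
    using cInf_lessD[of "J ` PK" "m + 1 / real (Suc n)"] unfolding C_def m_def[symmetric]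
    by (auto simp: less_imp_le)
  have C_dec: "decseq C"
    unfolding decseq_def C_def
  proof (intro allI impI subsetI, clarsimp)
    fix k n :: nat and u assume "k \<le> n" "J u \<le> m + 1 / (1 + real n)"
    moreover have "1 / (1 + real n) \<le> 1 / (1 + real k)"
      using \<open>k \<le> n\<close> by (intro divide_left_mono) auto
    ultimately show "J u \<le> m + 1 / (1 + real k)" by linarith
  qed
  have C_mid: "(\<lambda>j x. (u j x + v j x) / 2) \<in> C n" if "u \<in> C n" "v \<in> C n" for u v n
  proof -
    have uv: "u j \<in> K j" "v j \<in> K j" if "j \<in> I" for j
      using \<open>u \<in> C n\<close> \<open>v \<in> C n\<close> that by (auto simp: C_def PK_def)
    have "(\<lambda>x. (u j x + v j x) / 2) \<in> K j" if "j \<in> I" for j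
      by (rule K_midpoint[OF that uv[OF that]])
    then have mid: "(\<lambda>j x. (u j x + v j x) / 2) \<in> PK" by (auto simp: PK_def)
    have ints: "integrable M (\<lambda>x. exp (- \<epsilon> * gmean (\<lambda>i. u i x)))"
        "integrable M (\<lambda>x. exp (- \<epsilon> * gmean (\<lambda>i. v i x)))"
        "integrable M (\<lambda>x. exp (- \<epsilon> * gmean (\<lambda>i. (u i x + v i x) / 2)))"
    proof -
      have [measurable]: "u i \<in> borel_measurable M" "v i \<in> borel_measurable M" if "i \<in> I" for i
        using uv[OF that] K_measurable[OF that] by auto
      show "integrable M (\<lambda>x. exp (- \<epsilon> * gmean (\<lambda>i. u i x)))" by (rule J_int) measurable
      show "integrable M (\<lambda>x. exp (- \<epsilon> * gmean (\<lambda>i. v i x)))" by (rule J_int) measurable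
      show "integrable M (\<lambda>x. exp (- \<epsilon> * gmean (\<lambda>i. (u i x + v i x) / 2)))" by (rule J_int) measurable
    qed
    have "J (\<lambda>j x. (u j x + v j x) / 2) \<le> (\<integral>x. (1 - 1/2) * exp (- \<epsilon> * gmean (\<lambda>i. u i x)) + 1/2 * exp (- \<epsilon> * gmean (\<lambda>i. v i x)) \<partial>M)"
      unfolding J_def
    proof (rule integral_mono)
      show "exp (- \<epsilon> * gmean (\<lambda>i. (u i x + v i x) / 2))
          \<le> (1 - 1/2) * exp (- \<epsilon> * gmean (\<lambda>i. u i x)) + 1/2 * exp (- \<epsilon> * gmean (\<lambda>i. v i x))" for x
        using exp_gmean_convex[of "\<lambda>i. u i x" "\<lambda>i. v i x" "1/2" \<epsilon>] K_nonneg[OF _ uv(1)] K_nonneg[OF _ uv(2)] \<epsilon>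
        by (simp add: add_divide_distrib)
    qed (use ints in auto)
    also have "\<dots> = (1 - 1/2) * J u + 1/2 * J v"
      unfolding J_def using ints by simp
    also have "\<dots> \<le> m + 1 / real (Suc n)"
      using that by (simp add: C_def)
    finally show ?thesis using mid by (simp add: C_def)
  qed
  obtain F where F: "\<And>n. F n \<in> C n" "\<And>j. j \<in> I \<Longrightarrow> AE x in M. convergent (\<lambda>n. exp (- F n j x / 2))"
    by (rule nested_convex_AE_convergent[OF finite_index C_dec C_ne _ _ C_mid])
      (auto simp: C_def PK_def intro: K_measurable K_nonneg)
  have FK: "F n j \<in> K j" if "j \<in> I" for n j using F(1)[of n] that by (auto simp: C_def PK_def)
  have F_meas: "F n j \<in> borel_measurable M" if "j \<in> I" for n j
    using FK[OF that] that K_measurable by auto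
  have "AE x in M. \<not> filterlim (\<lambda>n. gmean (\<lambda>i. F n i x)) at_top sequentially"
    by (rule AE_not_at_top_if_nn_integral_bounded[OF _ gmean_bound]) (use F_meas FK in auto)
  moreover have AE_pos: "AE x in M. \<forall>j\<in>I. 0 < c j x"
    by (intro AE_finite_allI finite_index pos)
  moreover have "AE x in M. \<forall>j\<in>I. convergent (\<lambda>n. exp (- F n j x / 2))"
    by (intro AE_finite_allI finite_index F)
  ultimately have F_conv: "AE x in M. \<forall>j\<in>I. convergent (\<lambda>n. F n j x)"
  proof eventually_elim
    case (elim x)
    show ?case
    proof
      fix j assume j: "j \<in> I"
      have "\<not> filterlim (\<lambda>n. F n j x) at_top sequentially"
        using gmean_at_top[OF j, of "\<lambda>n i. F n i x" sequentially "\<lambda>i. c i x"] elim floor[OF _ FK] by auto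
      then show "convergent (\<lambda>n. F n j x)"
        using convergent_or_at_top_if_convergent_exp[of "\<lambda>n. F n j x"] elim(3) j by blast
    qed
  qed
  \<comment> \<open>The maximum with \<open>0\<close> only matters on the null set where the limit does not exist.\<close>
  define U where "U j x = max 0 (lim (\<lambda>n. F n j x))" for j x
  have U_meas: "U j \<in> borel_measurable M" if "j \<in> I" for j
    unfolding U_def using F_meas[OF that] by measurable
  have F_lim: "AE x in M. \<forall>j\<in>I. (\<lambda>n. F n j x) \<longlonglongrightarrow> U j x"
    using F_conv
  proof eventually_elim
    case (elim x)
    show ?case
    proof
      fix j assume j: "j \<in> I"
      then have l: "(\<lambda>n. F n j x) \<longlonglongrightarrow> lim (\<lambda>n. F n j x)"
        using elim by (auto simp: convergent_LIMSEQ_iff)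
      have "0 \<le> lim (\<lambda>n. F n j x)"
        by (rule LIMSEQ_le_const[OF l]) (use K_nonneg[OF j FK[OF j]] in auto)
      with l show "(\<lambda>n. F n j x) \<longlonglongrightarrow> U j x" by (simp add: U_def)
    qed
  qed
  have "m \<le> J (F n)" "J (F n) \<le> m + 1 / real (Suc n)" for n
    using F(1)[of n] m_le by (auto simp: C_def)
  then have "(\<lambda>n. J (F n)) \<longlonglongrightarrow> m"
    by (intro tendsto_sandwich[OF _ _ tendsto_const LIMSEQ_inverse_real_of_nat_add[of m]] always_eventually)
      (auto simp: inverse_eq_divide)
  moreover have "(\<lambda>n. J (F n)) \<longlonglongrightarrow> J U"
    by (rule J_lim) (use F_meas U_meas F_lim K_nonneg FK in auto)
  ultimately have JU: "J U = m" by (metis LIMSEQ_unique)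
  show ?thesis
  proof (rule that)
    show "U j \<in> borel_measurable M" if "j \<in> I" for j by (rule U_meas[OF that])
    show "0 \<le> U j x" for j x by (simp add: U_def)
    show "AE x in M. 0 < U j x" if j: "j \<in> I" for j
      using F_lim AE_pos
    proof eventually_elim
      case (elim x)
      have "c j x \<le> U j x"
        by (rule LIMSEQ_le_const[of "\<lambda>n. F n j x"]) (use elim j floor[OF j FK[OF j]] in auto)
      with elim j show ?case by force
    qed
    show "(\<integral>\<^sup>+x. ennreal (gmean (\<lambda>j. U j x)) \<partial>M) \<le> ennreal A"
    proof (rule nn_integral_le_if_AE_tendsto[OF _ _ gmean_bound tendsto_const])
      show "AE x in M. (\<lambda>n. ennreal (gmean (\<lambda>j. F n j x))) \<longlonglongrightarrow> ennreal (gmean (\<lambda>j. U j x))"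
        using F_lim by eventually_elim (intro tendsto_ennrealI tendsto_gmean, use K_nonneg FK in auto)
    qed (use F_meas FK in auto)
    show "(\<integral>x. exp (- \<epsilon> * gmean (\<lambda>i. U i x)) \<partial>M)
        \<le> (\<integral>x. exp (- \<epsilon> * gmean ((\<lambda>i. U i x)(j := (1 - t) * U j x + t * v x))) \<partial>M)"
      if j: "j \<in> I" and v: "v \<in> K j" and t: "0 \<le> t" "t \<le> 1" for j v t
    proof -
      define Z where "Z n = (F n)(j := (\<lambda>x. (1 - t) * F n j x + t * v x))" for n
      define ZU where "ZU = U(j := (\<lambda>x. (1 - t) * U j x + t * v x))"
      have ZK: "Z n i \<in> K i" if "i \<in> I" for n i
        using FK[OF that] K_convex[OF j FK[OF j] v t] by (auto simp: Z_def)
      then have "Z n \<in> PK" for n by (auto simp: PK_def)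
      then have "m \<le> J (Z n)" for n by (rule m_le)
      moreover have "(\<lambda>n. J (Z n)) \<longlonglongrightarrow> J ZU"
      proof (rule J_lim)
        show "ZU i \<in> borel_measurable M" if "i \<in> I" for i
          using U_meas[OF that] U_meas[OF j] K_measurable[OF j v] by (auto simp: ZU_def)
        show "AE x in M. \<forall>i\<in>I. (\<lambda>n. Z n i x) \<longlonglongrightarrow> ZU i x"
          using F_lim
        proof eventually_elim
          case (elim x)
          then show ?case using j by (auto simp: Z_def ZU_def intro!: tendsto_intros)
        qed
      qed (use ZK K_measurable K_nonneg in auto)
      ultimately have "m \<le> J ZU" by (intro LIMSEQ_le_const) auto
      moreover have "(\<lambda>i. ZU i x) = (\<lambda>i. U i x)(j := (1 - t) * U j x + t * v x)" for x
        by (auto simp: ZU_def)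
      ultimately show ?thesis by (simp add: JU[symmetric] J_def)
    qed
  qed
qed

section \<open>Approximate factorisation\<close>

text \<open>With \<open>G = G(U)\<close> for the minimiser \<open>U\<close>, the functions \<open>g\<^sub>j = exp (-\<epsilon> G) G / U\<^sub>j\<close> have geometric mean
  \<open>exp (-\<epsilon> G) \<ge> 1 - \<epsilon> G\<close>.\<close>

lemma approximate_factorisation_of_floor:
  assumes \<epsilon>: "0 < \<epsilon>"
    and ne: "\<And>j. j \<in> I \<Longrightarrow> K j \<noteq> {}"
    and floor: "\<And>j u x. j \<in> I \<Longrightarrow> u \<in> K j \<Longrightarrow> c j x \<le> u x"
    and pos: "\<And>j. j \<in> I \<Longrightarrow> AE x in M. 0 < c j x"
  obtains g where "\<And>j. j \<in> I \<Longrightarrow> g j \<in> borel_measurable M" "\<And>j x. 0 \<le> g j x"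
    "\<And>j v. j \<in> I \<Longrightarrow> v \<in> K j \<Longrightarrow> (\<integral>\<^sup>+x. ennreal (g j x * v x) \<partial>M) \<le> ennreal A"
    "(\<integral>\<^sup>+x. ennreal (1 - gmean (\<lambda>j. g j x)) \<partial>M) \<le> ennreal (\<epsilon> * A)"
proof -
  obtain U where U [measurable]: "\<And>j. j \<in> I \<Longrightarrow> U j \<in> borel_measurable M" and U0: "\<And>j x. 0 \<le> U j x"
    and Upos: "\<And>j. j \<in> I \<Longrightarrow> AE x in M. 0 < U j x"
    and UA: "(\<integral>\<^sup>+x. ennreal (gmean (\<lambda>j. U j x)) \<partial>M) \<le> ennreal A"
    and Umin: "\<And>j v t. j \<in> I \<Longrightarrow> v \<in> K j \<Longrightarrow> 0 \<le> t \<Longrightarrow> t \<le> 1 \<Longrightarrow>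
      (\<integral>x. exp (- \<epsilon> * gmean (\<lambda>i. U i x)) \<partial>M)
        \<le> (\<integral>x. exp (- \<epsilon> * gmean ((\<lambda>i. U i x)(j := (1 - t) * U j x + t * v x))) \<partial>M)"
    by (rule exists_limit_minimizer[where c=c], rule \<epsilon>, erule ne, erule (1) floor, erule pos) (rule that)
  define G where "G x = gmean (\<lambda>i. U i x)" for x
  have [measurable]: "G \<in> borel_measurable M" unfolding G_def by measurable
  have G0: "0 \<le> G x" for x by (simp add: G_def gmean_nonneg)
  define g where "g j x = exp (- \<epsilon> * G x) * G x / U j x" for j x
  show ?thesis
  proof (rule that)
    show "g j \<in> borel_measurable M" if [simp]: "j \<in> I" for j
      unfolding g_def by measurable
    show "0 \<le> g j x" for j x using G0 U0 by (simp add: g_def)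
    show "(\<integral>\<^sup>+x. ennreal (g j x * v x) \<partial>M) \<le> ennreal A" if j: "j \<in> I" and v: "v \<in> K j" for j v
    proof -
      show ?thesis
        unfolding g_def G_def
        by (rule first_order_condition[OF finite_measure_axioms j \<epsilon> A_nonneg U K_measurable[OF j v] U0 K_nonneg[OF j v] Upos[OF j] UA Umin[OF j v]])
    qed
    have "AE x in M. ennreal (1 - gmean (\<lambda>j. g j x)) \<le> ennreal \<epsilon> * ennreal (G x)"
    proof -
      have "AE x in M. \<forall>j\<in>I. 0 < U j x" by (intro AE_finite_allI finite_index Upos)
      then show ?thesis
      proof eventually_elim
        case (elim x)
        then have Gp: "0 < G x" unfolding G_def by (intro gmean_pos) auto
        have "exp (- \<epsilon> * G x) * G x = gmean (\<lambda>j. exp (- \<epsilon> * G x) * G x)"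
          using Gp by (simp add: gmean_const)
        also have "\<dots> = gmean (\<lambda>j. g j x * U j x)"
          using elim by (intro gmean_cong) (auto simp: g_def)
        also have "\<dots> = gmean (\<lambda>j. g j x) * G x"
          unfolding G_def using G0 U0 by (intro gmean_mult) (auto simp: g_def G_def)
        finally have "gmean (\<lambda>j. g j x) = exp (- \<epsilon> * G x)" using Gp by simp
        then have "1 - gmean (\<lambda>j. g j x) \<le> \<epsilon> * G x"
          using exp_ge_add_one_self[of "- \<epsilon> * G x"] by linarith
        then show ?case using \<epsilon> G0[of x] by (simp add: ennreal_mult[symmetric] ennreal_leI)
      qed
    qed
    then have "(\<integral>\<^sup>+x. ennreal (1 - gmean (\<lambda>j. g j x)) \<partial>M) \<le> (\<integral>\<^sup>+x. ennreal \<epsilon> * ennreal (G x) \<partial>M)"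
      by (rule nn_integral_mono_AE)
    also have "\<dots> = ennreal \<epsilon> * (\<integral>\<^sup>+x. ennreal (G x) \<partial>M)" by (rule nn_integral_cmult) auto
    also have "\<dots> \<le> ennreal \<epsilon> * ennreal A" using UA by (intro mult_left_mono) (auto simp: G_def)
    finally show "(\<integral>\<^sup>+x. ennreal (1 - gmean (\<lambda>j. g j x)) \<partial>M) \<le> ennreal (\<epsilon> * A)"
      using \<epsilon> A_nonneg by (simp add: ennreal_mult)
  qed
qed

text \<open>The families \<open>(1 - \<delta>) K\<^sub>j + \<delta> h\<^sub>j\<close> are contained in \<open>K\<^sub>j\<close> and bounded below by \<open>\<delta> h\<^sub>j\<close>. A bound on
  them carries over to \<open>K\<^sub>j\<close> with the loss of a factor \<open>1 - \<delta>\<close>.\<close>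

lemma approximate_factorisation_of_positive:
  assumes \<epsilon>: "0 < \<epsilon>" and \<delta>: "0 < \<delta>" "\<delta> < 1"
    and h: "\<And>j. j \<in> I \<Longrightarrow> h j \<in> K j" "\<And>j. j \<in> I \<Longrightarrow> AE x in M. 0 < h j x"
  obtains g where "\<And>j. j \<in> I \<Longrightarrow> g j \<in> borel_measurable M" "\<And>j x. 0 \<le> g j x"
    "\<And>j v. j \<in> I \<Longrightarrow> v \<in> K j \<Longrightarrow> (\<integral>\<^sup>+x. ennreal (g j x * v x) \<partial>M) \<le> ennreal (A / (1 - \<delta>))"
    "(\<integral>\<^sup>+x. ennreal (1 - gmean (\<lambda>j. g j x)) \<partial>M) \<le> ennreal (\<epsilon> * A)"
proof -
  define K' where "K' j = (\<lambda>u x. (1 - \<delta>) * u x + \<delta> * h j x) ` K j" for j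
  define c where "c j x = max 0 (\<delta> * h j x)" for j x
  have sub: "u \<in> K j" if "j \<in> I" "u \<in> K' j" for j u
    using that K_convex[OF that(1) _ h(1)[OF that(1)]] \<delta> by (auto simp: K'_def)
  have floor: "c j x \<le> u x" if "j \<in> I" "u \<in> K' j" for j u x
    using that K_nonneg[OF that(1)] h(1)[OF that(1)] \<delta> by (auto simp: K'_def c_def)
  interpret K': convex_families I \<alpha> M K' A
  proof
    show "u \<in> borel_measurable M" if "j \<in> I" "u \<in> K' j" for j u
      using K_measurable sub that by blast
    show "0 \<le> u x" if "j \<in> I" "u \<in> K' j" for j u x
      using K_nonneg sub that by blast
    show "(\<lambda>x. (1 - s) * u x + s * v x) \<in> K' j"
      if "j \<in> I" "u \<in> K' j" "v \<in> K' j" "0 \<le> s" "s \<le> 1" for j u v s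
    proof -
      from that(2,3) obtain u0 v0 where 0: "u0 \<in> K j" "u = (\<lambda>x. (1 - \<delta>) * u0 x + \<delta> * h j x)"
        "v0 \<in> K j" "v = (\<lambda>x. (1 - \<delta>) * v0 x + \<delta> * h j x)"
        by (auto simp: K'_def)
      have "(\<lambda>x. (1 - s) * u x + s * v x) = (\<lambda>x. (1 - \<delta>) * ((1 - s) * u0 x + s * v0 x) + \<delta> * h j x)"
        by (simp add: 0 algebra_simps)
      then show ?thesis
        unfolding K'_def using K_convex[OF that(1) 0(1,3) that(4,5)] by (intro image_eqI)
    qed
    show "(\<integral>\<^sup>+x. ennreal (gmean (\<lambda>j. u j x)) \<partial>M) \<le> ennreal A" if "\<And>j. j \<in> I \<Longrightarrow> u j \<in> K' j" for u
      using that sub by (intro gmean_bound) blast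
  qed (rule A_nonneg)
  have ne: "K' j \<noteq> {}" if "j \<in> I" for j using h(1)[OF that] by (auto simp: K'_def)
  have pos: "AE x in M. 0 < c j x" if "j \<in> I" for j
    using h(2)[OF that] by eventually_elim (use \<delta> in \<open>simp add: c_def less_max_iff_disj\<close>)
  obtain g where g: "\<And>j. j \<in> I \<Longrightarrow> g j \<in> borel_measurable M" "\<And>j x. 0 \<le> g j x"
    "\<And>j v. j \<in> I \<Longrightarrow> v \<in> K' j \<Longrightarrow> (\<integral>\<^sup>+x. ennreal (g j x * v x) \<partial>M) \<le> ennreal A"
    "(\<integral>\<^sup>+x. ennreal (1 - gmean (\<lambda>j. g j x)) \<partial>M) \<le> ennreal (\<epsilon> * A)"
    by (rule K'.approximate_factorisation_of_floor[where c=c], rule \<epsilon>, erule ne, erule (1) floor, erule pos) (rule that)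
  show ?thesis
  proof (rule that[of g])
    fix j v assume j: "j \<in> I" and v: "v \<in> K j"
    note [measurable] = g(1)[OF j] K_measurable[OF j v]
    have "ennreal (1 - \<delta>) * (\<integral>\<^sup>+x. ennreal (g j x * v x) \<partial>M) = (\<integral>\<^sup>+x. ennreal ((1 - \<delta>) * (g j x * v x)) \<partial>M)"
      using \<delta> g(2) K_nonneg[OF j v] by (subst nn_integral_cmult[symmetric]) (auto simp: ennreal_mult)
    also have "\<dots> \<le> (\<integral>\<^sup>+x. ennreal (g j x * ((1 - \<delta>) * v x + \<delta> * h j x)) \<partial>M)"
      using \<delta> g(2) K_nonneg[OF j h(1)[OF j]] by (intro nn_integral_mono ennreal_leI) (simp add: algebra_simps)
    also have "\<dots> \<le> ennreal A" using v by (intro g(3) j) (auto simp: K'_def)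
    also have "ennreal A = ennreal (1 - \<delta>) * ennreal (A / (1 - \<delta>))"
      using \<delta> A_nonneg by (simp add: ennreal_mult[symmetric])
    finally show "(\<integral>\<^sup>+x. ennreal (g j x * v x) \<partial>M) \<le> ennreal (A / (1 - \<delta>))"
      using \<delta> by (subst (asm) ennreal_mult_le_mult_iff) auto
  qed (use g in auto)
qed

text \<open>Saturation only gives functions \<open>h\<^sub>j\<close> that are positive off a small set \<open>N\<close>. On its complement \<open>B\<close>
  the previous lemma applies; on \<open>N\<close> the functions \<open>g\<^sub>j\<close> are set to zero, which costs at most the
  measure of \<open>N\<close>. The positive part of \<open>1 - G(g)\<close> measures the failure of \<open>G(g) \<ge> 1\<close> in a way
  that is convex in \<open>g\<close>, as the limiting argument requires.\<close>

lemma approximate_factorisation: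
  assumes ne: "\<And>j. j \<in> I \<Longrightarrow> K j \<noteq> {}"
    and sat: "\<And>j E. j \<in> I \<Longrightarrow> E \<in> sets M \<Longrightarrow> 0 < emeasure M E \<Longrightarrow>
      \<exists>E'\<in>sets M. E' \<subseteq> E \<and> 0 < emeasure M E' \<and> (\<exists>h\<in>K j. AE x in M. x \<in> E' \<longrightarrow> 0 < h x)"
    and \<eta>: "0 < \<eta>"
  obtains g where "\<And>j. j \<in> I \<Longrightarrow> g j \<in> borel_measurable M" "\<And>j x. 0 \<le> g j x"
    "\<And>j v. j \<in> I \<Longrightarrow> v \<in> K j \<Longrightarrow> (\<integral>\<^sup>+x. ennreal (g j x * v x) \<partial>M) \<le> ennreal (A + \<eta>)"
    "(\<integral>\<^sup>+x. ennreal (1 - gmean (\<lambda>j. g j x)) \<partial>M) \<le> ennreal \<eta>"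
proof -
  \<comment> \<open>The exceptional sets are allotted shares of \<open>\<eta> / 2\<close> by the weights, which add up to \<open>1\<close>.\<close>
  have "\<exists>h. h \<in> K j \<and> measure M {x \<in> space M. h x \<le> 0} < \<eta> / 2 * \<alpha> j" if j: "j \<in> I" for j
  proof -
    obtain k where k: "\<And>n. k n \<in> K j" "AE x in M. \<exists>n. 0 < k n x"
      "(\<lambda>n. measure M {x \<in> space M. k n x \<le> 0}) \<longlonglongrightarrow> 0"
      by (rule convex_saturating_almost_positive[of "K j"], rule ne[OF j], erule K_measurable[OF j],
          erule K_nonneg[OF j], erule (1) K_midpoint[OF j], erule (1) sat[OF j]) (rule that)
    have "0 < \<eta> / 2 * \<alpha> j" using \<eta> weight_pos[OF j] by simp
    from order_tendstoD(2)[OF k(3) this] k(1) show ?thesis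
      by (auto simp: eventually_sequentially)
  qed
  then have "\<forall>j\<in>I. \<exists>h. h \<in> K j \<and> measure M {x \<in> space M. h x \<le> 0} < \<eta> / 2 * \<alpha> j" by blast
  from bchoice[OF this] obtain h where h: "\<And>j. j \<in> I \<Longrightarrow> h j \<in> K j"
    "\<And>j. j \<in> I \<Longrightarrow> measure M {x \<in> space M. h j x \<le> 0} < \<eta> / 2 * \<alpha> j"
    by blast
  have h_meas [measurable]: "h j \<in> borel_measurable M" if "j \<in> I" for j using K_measurable h(1) that by blast
  define N where "N = (\<Union>j\<in>I. {x \<in> space M. h j x \<le> 0})"
  define B where "B = space M - N"
  have N_sets [measurable]: "N \<in> sets M"
    unfolding N_def using finite_index h_meas by (intro sets.finite_UN) auto
  have B_sets [measurable]: "B \<in> sets M" unfolding B_def by measurable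
  have "measure M N \<le> (\<Sum>j\<in>I. measure M {x \<in> space M. h j x \<le> 0})"
    unfolding N_def by (intro finite_measure_subadditive_finite finite_index) (auto simp: h_meas)
  also have "\<dots> \<le> (\<Sum>j\<in>I. \<eta> / 2 * \<alpha> j)" using h(2) by (intro sum_mono) (auto simp: less_imp_le)
  also have "\<dots> = \<eta> / 2 * (\<Sum>j\<in>I. \<alpha> j)" by (rule sum_distrib_left[symmetric])
  also have "\<dots> = \<eta> / 2" by (simp add: sum_weights)
  finally have N: "measure M N \<le> \<eta> / 2" .
  define M' where "M' = density M (indicator B)"
  have M'_nn: "(\<integral>\<^sup>+x. f x \<partial>M') = (\<integral>\<^sup>+x. indicator B x * f x \<partial>M)" if "f \<in> borel_measurable M" for f
    unfolding M'_def using that by (subst nn_integral_density) auto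
  have M'_le: "(\<integral>\<^sup>+x. f x \<partial>M') \<le> (\<integral>\<^sup>+x. f x \<partial>M)" if "f \<in> borel_measurable M" for f
    unfolding M'_nn[OF that] by (intro nn_integral_mono) (auto simp: indicator_def)
  have M'_meas [simp]: "borel_measurable M' = borel_measurable M"
    by (rule measurable_cong_sets) (simp_all add: M'_def)
  interpret M'_finite: finite_measure M'
  proof (rule finite_measureI)
    have "emeasure M' (space M') \<le> emeasure M (space M)"
      using M'_le[of "\<lambda>_. 1"] by simp
    then show "emeasure M' (space M') \<noteq> \<infinity>"
      using emeasure_finite[of "space M"] by (auto simp: top_unique)
  qed
  interpret M': convex_families I \<alpha> M' K A
  proof
    show "(\<integral>\<^sup>+x. ennreal (gmean (\<lambda>j. u j x)) \<partial>M') \<le> ennreal A" if "\<And>j. j \<in> I \<Longrightarrow> u j \<in> K j" for u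
      using K_measurable that by (intro order_trans[OF M'_le gmean_bound]) auto
  qed (use K_measurable K_nonneg K_convex A_nonneg in auto)
  \<comment> \<open>Chosen so that \<open>A / (1 - \<delta>) \<le> A + \<eta>\<close> and \<open>\<epsilon> * A \<le> \<eta> / 2\<close>; the summand \<open>1\<close> allows \<open>A = 0\<close>.\<close>
  define \<delta> where "\<delta> = \<eta> / (A + \<eta> + 1)"
  define \<epsilon> where "\<epsilon> = (\<eta> / 2) / (A + 1)"
  have \<delta>: "0 < \<delta>" "\<delta> < 1" using \<eta> A_nonneg by (auto simp: \<delta>_def)
  have \<delta>A: "A / (1 - \<delta>) \<le> A + \<eta>"
  proof -
    have "(A + \<eta>) * (1 - \<delta>) = A + \<eta> - \<delta> * (A + \<eta>)" by (simp add: algebra_simps)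
    moreover have "\<delta> * (A + \<eta>) \<le> \<delta> * (A + \<eta> + 1)" using \<delta> by (intro mult_left_mono) auto
    moreover have "\<delta> * (A + \<eta> + 1) = \<eta>" using \<eta> A_nonneg by (simp add: \<delta>_def)
    ultimately have "A \<le> (A + \<eta>) * (1 - \<delta>)" by linarith
    then show ?thesis using \<delta> by (simp add: pos_divide_le_eq)
  qed
  have \<epsilon>: "0 < \<epsilon>" using \<eta> A_nonneg by (simp add: \<epsilon>_def)
  have \<epsilon>A: "\<epsilon> * A \<le> \<eta> / 2"
  proof -
    have "\<epsilon> * A \<le> \<epsilon> * (A + 1)" using \<epsilon> by (intro mult_left_mono) auto
    also have "\<dots> = \<eta> / 2"
      using A_nonneg unfolding \<epsilon>_def by (intro nonzero_eq_divide_eq[THEN iffD1, OF _ refl]) linarith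
    finally show ?thesis .
  qed
  have h_pos: "AE x in M'. 0 < h j x" if "j \<in> I" for j
  proof -
    have "AE x in M. (0::ennreal) < indicator B x \<longrightarrow> 0 < h j x"
      using that by (intro AE_I2) (auto simp: B_def N_def not_le split: split_indicator_asm)
    then show ?thesis unfolding M'_def by (subst AE_density) auto
  qed
  obtain g where g: "\<And>j. j \<in> I \<Longrightarrow> g j \<in> borel_measurable M'" "\<And>j x. 0 \<le> g j x"
    "\<And>j v. j \<in> I \<Longrightarrow> v \<in> K j \<Longrightarrow> (\<integral>\<^sup>+x. ennreal (g j x * v x) \<partial>M') \<le> ennreal (A / (1 - \<delta>))"
    "(\<integral>\<^sup>+x. ennreal (1 - gmean (\<lambda>j. g j x)) \<partial>M') \<le> ennreal (\<epsilon> * A)"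
    by (rule M'.approximate_factorisation_of_positive[where h=h], rule \<epsilon>, rule \<delta>(1), rule \<delta>(2),
        erule h(1), erule h_pos) (rule that)
  have g_meas [measurable]: "g j \<in> borel_measurable M" if "j \<in> I" for j using g(1)[OF that] by simp
  show ?thesis
  proof (rule that)
    show "(\<lambda>x. indicator B x * g j x) \<in> borel_measurable M" if [simp]: "j \<in> I" for j by measurable
    show "0 \<le> indicator B x * g j x" for j x using g(2) by simp
    show "(\<integral>\<^sup>+x. ennreal (indicator B x * g j x * v x) \<partial>M) \<le> ennreal (A + \<eta>)" if j: "j \<in> I" and v: "v \<in> K j" for j v
    proof -
      have "(\<integral>\<^sup>+x. ennreal (indicator B x * g j x * v x) \<partial>M) = (\<integral>\<^sup>+x. ennreal (g j x * v x) \<partial>M')"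
        using g_meas[OF j] K_measurable[OF j v]
        by (subst M'_nn) (auto intro!: nn_integral_cong simp: indicator_def)
      also note g(3)[OF j v]
      also have "ennreal (A / (1 - \<delta>)) \<le> ennreal (A + \<eta>)" using \<delta>A by (rule ennreal_leI)
      finally show ?thesis .
    qed
    have "(\<integral>\<^sup>+x. ennreal (1 - gmean (\<lambda>j. indicator B x * g j x)) \<partial>M)
        \<le> (\<integral>\<^sup>+x. indicator B x * ennreal (1 - gmean (\<lambda>j. g j x)) + indicator N x \<partial>M)"
    proof (rule nn_integral_mono)
      fix x assume x: "x \<in> space M"
      show "ennreal (1 - gmean (\<lambda>j. indicator B x * g j x))
          \<le> indicator B x * ennreal (1 - gmean (\<lambda>j. g j x)) + indicator N x"
      proof (cases "x \<in> B")
        case False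
        then have "x \<in> N" using x by (simp add: B_def)
        have "ennreal (1 - gmean (\<lambda>j. indicator B x * g j x)) \<le> ennreal 1"
          by (intro ennreal_leI) (simp add: gmean_nonneg)
        then show ?thesis using False \<open>x \<in> N\<close> by simp
      qed auto
    qed
    also have "\<dots> = (\<integral>\<^sup>+x. ennreal (1 - gmean (\<lambda>j. g j x)) \<partial>M') + emeasure M N"
      by (subst nn_integral_add) (auto simp: M'_nn)
    also have "\<dots> \<le> ennreal (\<eta> / 2) + ennreal (\<eta> / 2)"
    proof (rule add_mono)
      show "(\<integral>\<^sup>+x. ennreal (1 - gmean (\<lambda>j. g j x)) \<partial>M') \<le> ennreal (\<eta> / 2)"
        by (rule order_trans[OF g(4) ennreal_leI[OF \<epsilon>A]])
      show "emeasure M N \<le> ennreal (\<eta> / 2)"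
        unfolding emeasure_eq_measure by (rule ennreal_leI[OF N])
    qed
    also have "\<dots> = ennreal \<eta>" using \<eta> by (simp add: ennreal_plus[symmetric] del: ennreal_plus)
    finally show "(\<integral>\<^sup>+x. ennreal (1 - gmean (\<lambda>j. indicator B x * g j x)) \<partial>M) \<le> ennreal \<eta>" .
  qed
qed

section \<open>Factorisation\<close>

text \<open>The sets \<open>C n\<close> of solutions with error \<open>\<eta> n\<close> are convex, nonempty and decreasing, so solutions can
  be selected which converge. Their limit in the \<open>j\<close>-th coordinate is finite wherever some member of
  \<open>K j\<close> is positive, by the bound on \<open>\<integral> g\<^sub>j v\<close>; that is almost everywhere.\<close>

theorem factorisation:
  assumes ne: "\<And>j. j \<in> I \<Longrightarrow> K j \<noteq> {}"
    and sat: "\<And>j E. j \<in> I \<Longrightarrow> E \<in> sets M \<Longrightarrow> 0 < emeasure M E \<Longrightarrow>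
      \<exists>E'\<in>sets M. E' \<subseteq> E \<and> 0 < emeasure M E' \<and> (\<exists>h\<in>K j. AE x in M. x \<in> E' \<longrightarrow> 0 < h x)"
  obtains g where "\<And>j. j \<in> I \<Longrightarrow> g j \<in> borel_measurable M" "\<And>j x. 0 \<le> g j x"
    "\<And>j v. j \<in> I \<Longrightarrow> v \<in> K j \<Longrightarrow> (\<integral>\<^sup>+x. ennreal (g j x * v x) \<partial>M) \<le> ennreal A"
    "AE x in M. 1 \<le> gmean (\<lambda>j. g j x)"
proof -
  define \<eta> where "\<eta> n = 1 / real (Suc n)" for n
  have \<eta>0: "0 < \<eta> n" for n by (simp add: \<eta>_def)
  have \<eta>_dec: "\<eta> n \<le> \<eta> m" if "m \<le> n" for m n
    unfolding \<eta>_def using that by (intro divide_left_mono) auto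
  have \<eta>_lim: "\<eta> \<longlonglongrightarrow> 0"
    using LIMSEQ_inverse_real_of_nat by (simp add: \<eta>_def[abs_def] inverse_eq_divide)
  define C where "C n = {g. (\<forall>j\<in>I. g j \<in> borel_measurable M \<and> (\<forall>x. 0 \<le> g j x) \<and>
      (\<forall>v\<in>K j. (\<integral>\<^sup>+x. ennreal (g j x * v x) \<partial>M) \<le> ennreal (A + \<eta> n))) \<and>
      (\<integral>\<^sup>+x. ennreal (1 - gmean (\<lambda>j. g j x)) \<partial>M) \<le> ennreal (\<eta> n)}" for n
  have C_ne: "C n \<noteq> {}" for n
  proof -
    obtain g where "\<And>j. j \<in> I \<Longrightarrow> g j \<in> borel_measurable M" "\<And>j x. 0 \<le> g j x"
      "\<And>j v. j \<in> I \<Longrightarrow> v \<in> K j \<Longrightarrow> (\<integral>\<^sup>+x. ennreal (g j x * v x) \<partial>M) \<le> ennreal (A + \<eta> n)"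
      "(\<integral>\<^sup>+x. ennreal (1 - gmean (\<lambda>j. g j x)) \<partial>M) \<le> ennreal (\<eta> n)"
      by (rule approximate_factorisation[OF ne sat \<eta>0[of n]]) (assumption+, rule that)
    then have "g \<in> C n" by (auto simp: C_def)
    then show ?thesis by auto
  qed
  have C_dec: "decseq C"
    unfolding decseq_def
  proof (intro allI impI subsetI)
    fix m n g assume mn: "m \<le> n" and g: "g \<in> C n"
    have "ennreal (\<eta> n) \<le> ennreal (\<eta> m)" "ennreal (A + \<eta> n) \<le> ennreal (A + \<eta> m)"
      using \<eta>_dec[OF mn] by (auto intro: ennreal_leI)
    with g show "g \<in> C m" unfolding C_def by (auto intro: order_trans)
  qed
  have C_mid: "(\<lambda>j x. (f j x + g j x) / 2) \<in> C n" if f: "f \<in> C n" and g: "g \<in> C n" for f g n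
  proof -
    have meas [measurable]: "f j \<in> borel_measurable M" "g j \<in> borel_measurable M" if "j \<in> I" for j
      using f g that by (auto simp: C_def)
    have nonneg: "0 \<le> f j x" "0 \<le> g j x" if "j \<in> I" for j x
      using f g that by (auto simp: C_def)
    have halve: "ennreal (1/2) * (ennreal a + ennreal b) = ennreal ((a + b) / 2)" if "0 \<le> a" "0 \<le> b" for a b
    proof -
      have "ennreal ((a + b) / 2) = ennreal (1/2 * (a + b))" by simp
      also have "\<dots> = ennreal (1/2) * ennreal (a + b)" using that by (intro ennreal_mult) auto
      also have "ennreal (a + b) = ennreal a + ennreal b" using that by (rule ennreal_plus)
      finally show ?thesis by (rule sym)
    qed
    have half: "(\<integral>\<^sup>+x. ennreal (1/2) * (ennreal (a x) + ennreal (b x)) \<partial>M) \<le> ennreal c"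
      if [measurable]: "a \<in> borel_measurable M" "b \<in> borel_measurable M"
        and "(\<integral>\<^sup>+x. ennreal (a x) \<partial>M) \<le> ennreal c" "(\<integral>\<^sup>+x. ennreal (b x) \<partial>M) \<le> ennreal c" "0 \<le> c"
      for a b :: "'a \<Rightarrow> real" and c
    proof -
      have "(\<integral>\<^sup>+x. ennreal (1/2) * (ennreal (a x) + ennreal (b x)) \<partial>M)
          = ennreal (1/2) * ((\<integral>\<^sup>+x. ennreal (a x) \<partial>M) + (\<integral>\<^sup>+x. ennreal (b x) \<partial>M))"
        by (subst nn_integral_cmult) (auto simp: nn_integral_add)
      also have "\<dots> \<le> ennreal (1/2) * (ennreal c + ennreal c)"
        using that by (intro mult_left_mono add_mono) auto
      also have "\<dots> = ennreal c"
        using halve[OF \<open>0 \<le> c\<close> \<open>0 \<le> c\<close>] by (simp only: field_sum_of_halves add_divide_distrib)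
      finally show ?thesis .
    qed
    have "(\<integral>\<^sup>+x. ennreal ((f j x + g j x) / 2 * v x) \<partial>M) \<le> ennreal (A + \<eta> n)" if j: "j \<in> I" and v: "v \<in> K j" for j v
    proof -
      note [measurable] = meas[OF j] K_measurable[OF j v]
      have "(\<integral>\<^sup>+x. ennreal ((f j x + g j x) / 2 * v x) \<partial>M)
          = (\<integral>\<^sup>+x. ennreal (1/2) * (ennreal (f j x * v x) + ennreal (g j x * v x)) \<partial>M)"
        
      proof (rule nn_integral_cong)
        fix x
        have "ennreal (1/2) * (ennreal (f j x * v x) + ennreal (g j x * v x)) = ennreal ((f j x * v x + g j x * v x) / 2)"
          using nonneg[OF j] K_nonneg[OF j v] by (intro halve) auto
        then show "ennreal ((f j x + g j x) / 2 * v x) = ennreal (1/2) * (ennreal (f j x * v x) + ennreal (g j x * v x))"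
          by (simp only: distrib_right times_divide_eq_left)
      qed
      also have "\<dots> \<le> ennreal (A + \<eta> n)"
        using f g j v A_nonneg \<eta>0[of n] by (intro half) (auto simp: C_def)
      finally show ?thesis .
    qed
    moreover have "(\<integral>\<^sup>+x. ennreal (1 - gmean (\<lambda>j. (f j x + g j x) / 2)) \<partial>M) \<le> ennreal (\<eta> n)"
    proof -
      have "(\<integral>\<^sup>+x. ennreal (1 - gmean (\<lambda>j. (f j x + g j x) / 2)) \<partial>M)
          \<le> (\<integral>\<^sup>+x. ennreal (1/2) * (ennreal (max 0 (1 - gmean (\<lambda>j. f j x))) + ennreal (max 0 (1 - gmean (\<lambda>j. g j x)))) \<partial>M)"
      proof (rule nn_integral_mono)
        fix x
        have "(1 - 1/2) * gmean (\<lambda>j. f j x) + 1/2 * gmean (\<lambda>j. g j x)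
            \<le> gmean (\<lambda>j. (1 - 1/2) * f j x + 1/2 * g j x)"
          using nonneg by (intro gmean_concave) auto
        then have "1 - gmean (\<lambda>j. (f j x + g j x) / 2)
            \<le> ((1 - gmean (\<lambda>j. f j x)) + (1 - gmean (\<lambda>j. g j x))) / 2"
          by (simp add: add_divide_distrib diff_divide_distrib)
        also have "\<dots> \<le> (max 0 (1 - gmean (\<lambda>j. f j x)) + max 0 (1 - gmean (\<lambda>j. g j x))) / 2"
          by (intro divide_right_mono add_mono) auto
        finally have "ennreal (1 - gmean (\<lambda>j. (f j x + g j x) / 2))
            \<le> ennreal ((max 0 (1 - gmean (\<lambda>j. f j x)) + max 0 (1 - gmean (\<lambda>j. g j x))) / 2)"
          by (rule ennreal_leI)
        also have "\<dots> = ennreal (1/2) * (ennreal (max 0 (1 - gmean (\<lambda>j. f j x))) + ennreal (max 0 (1 - gmean (\<lambda>j. g j x))))"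
          by (rule halve[symmetric]) auto
        finally show "ennreal (1 - gmean (\<lambda>j. (f j x + g j x) / 2))
            \<le> ennreal (1/2) * (ennreal (max 0 (1 - gmean (\<lambda>j. f j x))) + ennreal (max 0 (1 - gmean (\<lambda>j. g j x))))" .
      qed
      also have "\<dots> \<le> ennreal (\<eta> n)"
        using f g \<eta>0[of n] by (intro half) (auto simp: C_def ennreal_max_0)
      finally show ?thesis .
    qed
    moreover have "(\<lambda>x. (f j x + g j x) / 2) \<in> borel_measurable M" if [simp]: "j \<in> I" for j by measurable
    ultimately show ?thesis using nonneg by (auto simp: C_def)
  qed
  obtain F where F: "\<And>n. F n \<in> C n" "\<And>j. j \<in> I \<Longrightarrow> AE x in M. convergent (\<lambda>n. exp (- F n j x / 2))"
    by (rule nested_convex_AE_convergent[OF finite_index C_dec C_ne _ _ C_mid]) (auto simp: C_def)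
  have F_meas [measurable]: "F n j \<in> borel_measurable M" and F_nonneg: "0 \<le> F n j x"
    and F_int: "\<And>v. v \<in> K j \<Longrightarrow> (\<integral>\<^sup>+x. ennreal (F n j x * v x) \<partial>M) \<le> ennreal (A + \<eta> n)" if "j \<in> I" for n j x
    using F(1)[of n] that by (auto simp: C_def)
  have F_conv: "AE x in M. convergent (\<lambda>n. F n j x)" if j: "j \<in> I" for j
  proof -
    obtain k where k: "\<And>n. k n \<in> K j" "AE x in M. \<exists>n. 0 < k n x"
      "(\<lambda>n. measure M {x \<in> space M. k n x \<le> 0}) \<longlonglongrightarrow> 0"
      by (rule convex_saturating_almost_positive[of "K j"], rule ne[OF j], erule K_measurable[OF j],
          erule K_nonneg[OF j], erule (1) K_midpoint[OF j], erule (1) sat[OF j]) (rule that)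
    have "AE x in M. \<forall>m. \<not> filterlim (\<lambda>n. F n j x * k m x) at_top sequentially"
    proof (rule AE_all_countable[THEN iffD2], rule allI)
      fix m
      note [measurable] = F_meas[OF j] K_measurable[OF j k(1)[of m]]
      show "AE x in M. \<not> filterlim (\<lambda>n. F n j x * k m x) at_top sequentially"
      proof (rule AE_not_at_top_if_nn_integral_bounded)
        fix n
        show "(\<lambda>x. F n j x * k m x) \<in> borel_measurable M" by measurable
        have "ennreal (A + \<eta> n) \<le> ennreal (A + \<eta> 0)"
          using \<eta>_dec[of 0 n] by (intro ennreal_leI) simp
        then show "(\<integral>\<^sup>+x. ennreal (F n j x * k m x) \<partial>M) \<le> ennreal (A + \<eta> 0)"
          by (rule order_trans[OF F_int[OF j k(1)]])
      qed
    qed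
    with k(2) F(2)[OF j] show ?thesis
    proof eventually_elim
      case (elim x)
      then obtain m where m: "0 < k m x" by auto
      have "\<not> filterlim (\<lambda>n. F n j x) at_top sequentially"
      proof
        assume "filterlim (\<lambda>n. F n j x) at_top sequentially"
        then have "filterlim (\<lambda>n. F n j x * k m x) at_top sequentially"
          by (rule filterlim_at_top_mult_tendsto_pos[OF tendsto_const m])
        with elim(3) show False by simp
      qed
      then show ?case
        using convergent_or_at_top_if_convergent_exp[OF elim(2)] by simp
    qed
  qed
  define g where "g j x = max 0 (lim (\<lambda>n. F n j x))" for j x
  have g_meas [measurable]: "g j \<in> borel_measurable M" if [simp]: "j \<in> I" for j
    unfolding g_def by measurable
  have F_lim: "AE x in M. \<forall>j\<in>I. (\<lambda>n. F n j x) \<longlonglongrightarrow> g j x"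
  proof (rule AE_finite_allI[OF finite_index])
    fix j assume j: "j \<in> I"
    show "AE x in M. (\<lambda>n. F n j x) \<longlonglongrightarrow> g j x"
      using F_conv[OF j]
    proof eventually_elim
      case (elim x)
      then have l: "(\<lambda>n. F n j x) \<longlonglongrightarrow> lim (\<lambda>n. F n j x)"
        by (auto simp: convergent_LIMSEQ_iff)
      have "0 \<le> lim (\<lambda>n. F n j x)"
        by (rule LIMSEQ_le_const[OF l]) (use F_nonneg[OF j] in auto)
      with l show ?case by (simp add: g_def)
    qed
  qed
  show ?thesis
  proof (rule that)
    show "g j \<in> borel_measurable M" if "j \<in> I" for j by (rule g_meas[OF that])
    show "0 \<le> g j x" for j x by (simp add: g_def)
    show "(\<integral>\<^sup>+x. ennreal (g j x * v x) \<partial>M) \<le> ennreal A" if j: "j \<in> I" and v: "v \<in> K j" for j v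
    proof (rule nn_integral_le_if_AE_tendsto[OF _ _ F_int[OF j v]])
      show "(\<lambda>x. ennreal (F n j x * v x)) \<in> borel_measurable M" for n
        using F_meas[OF j] K_measurable[OF j v] by measurable
      show "AE x in M. (\<lambda>n. ennreal (F n j x * v x)) \<longlonglongrightarrow> ennreal (g j x * v x)"
        using F_lim by eventually_elim (use j in \<open>auto intro!: tendsto_intros tendsto_ennrealI\<close>)
      show "(\<lambda>n. ennreal (A + \<eta> n)) \<longlonglongrightarrow> ennreal A"
        using tendsto_add[OF tendsto_const \<eta>_lim, of A] by (intro tendsto_ennrealI) simp
    qed
    have "(\<integral>\<^sup>+x. ennreal (1 - gmean (\<lambda>j. g j x)) \<partial>M) \<le> 0"
    proof (rule nn_integral_le_if_AE_tendsto)
      show "(\<lambda>x. ennreal (1 - gmean (\<lambda>j. F n j x))) \<in> borel_measurable M" for n by measurable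
      show "AE x in M. (\<lambda>n. ennreal (1 - gmean (\<lambda>j. F n j x))) \<longlonglongrightarrow> ennreal (1 - gmean (\<lambda>j. g j x))"
        using F_lim by eventually_elim (use F_nonneg in \<open>auto intro!: tendsto_ennrealI tendsto_diff tendsto_gmean\<close>)
      show "(\<integral>\<^sup>+x. ennreal (1 - gmean (\<lambda>j. F n j x)) \<partial>M) \<le> ennreal (\<eta> n)" for n
        using F(1)[of n] by (simp add: C_def)
      show "(\<lambda>n. ennreal (\<eta> n)) \<longlonglongrightarrow> 0"
        using tendsto_ennrealI[OF \<eta>_lim] by simp
    qed
    then have "AE x in M. ennreal (1 - gmean (\<lambda>j. g j x)) = 0"
      by (subst nn_integral_0_iff_AE[symmetric]) auto
    then show "AE x in M. 1 \<le> gmean (\<lambda>j. g j x)"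
      by eventually_elim (simp add: ennreal_eq_0_iff)
  qed
qed

end

section \<open>Simple functions\<close>

text \<open>Gives access to the closure properties of \<open>simple_function\<close>. For the converse direction the sets of
  the linear combination are the level sets of \<open>f\<close> for nonzero values, and the coefficient of a
  level set is the value taken on it.\<close>

lemma simple_functions_iff:
  "f \<in> simple_functions Y \<longleftrightarrow>
    simple_function Y f \<and> emeasure Y {y \<in> space Y. f y \<noteq> 0} < \<infinity> \<and> (\<forall>y. y \<notin> space Y \<longrightarrow> f y = 0)"
proof
  assume "f \<in> simple_functions Y"
  then obtain F c where F: "finite F" "\<And>E. E \<in> F \<Longrightarrow> E \<in> sets Y" "\<And>E. E \<in> F \<Longrightarrow> emeasure Y E < \<infinity>"
    and f: "f = (\<lambda>y. \<Sum>E\<in>F. c E * indicator E y)"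
    by (auto simp: simple_functions_def)
  have "simple_function Y (\<lambda>y. c E * indicator E y)" if "E \<in> F" for E
    using simple_function_compose1[OF simple_function_indicator[OF F(2)[OF that]], of "\<lambda>t. c E * t"] .
  then have f_simple: "simple_function Y f" unfolding f by (rule simple_function_sum)
  have sub: "{y. f y \<noteq> 0} \<subseteq> \<Union>F"
    unfolding f by (auto intro!: sum.neutral simp: indicator_def)
  have "emeasure Y {y \<in> space Y. f y \<noteq> 0} \<le> emeasure Y (\<Union>E\<in>F. E)"
    using sub F by (intro emeasure_mono) auto
  also have "\<dots> \<le> (\<Sum>E\<in>F. emeasure Y E)"
    using F by (intro emeasure_subadditive_finite) auto
  also have "\<dots> < \<infinity>" using F(1,3) by simp
  finally have "emeasure Y {y \<in> space Y. f y \<noteq> 0} < \<infinity>" .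
  moreover have "f y = 0" if "y \<notin> space Y" for y
  proof (rule ccontr)
    assume "f y \<noteq> 0"
    then obtain E where "E \<in> F" "y \<in> E" using sub by auto
    with sets.sets_into_space[OF F(2)] that show False by auto
  qed
  ultimately show "simple_function Y f \<and> emeasure Y {y \<in> space Y. f y \<noteq> 0} < \<infinity> \<and> (\<forall>y. y \<notin> space Y \<longrightarrow> f y = 0)"
    using f_simple by auto
next
  assume f: "simple_function Y f \<and> emeasure Y {y \<in> space Y. f y \<noteq> 0} < \<infinity> \<and> (\<forall>y. y \<notin> space Y \<longrightarrow> f y = 0)"
  define L where "L v = f -` {v} \<inter> space Y" for v
  define V where "V = f ` space Y - {0}"
  define c where "c E = f (SOME y. y \<in> E)" for E
  have V: "finite V" using f simple_functionD(1)[of Y f] by (simp add: V_def)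
  have c_L: "c (L v) = v" if "v \<in> V" for v
  proof -
    have "(SOME y. y \<in> L v) \<in> L v" by (rule someI_ex) (use that in \<open>auto simp: V_def L_def\<close>)
    then show ?thesis by (simp add: c_def L_def)
  qed
  have inj: "inj_on L V" by (rule inj_on_inverseI[of V c]) (rule c_L)
  have f_eq: "f y = (\<Sum>E\<in>L ` V. c E * indicator E y)" for y
  proof -
    have "(\<Sum>E\<in>L ` V. c E * indicator E y) = (\<Sum>v\<in>V. v * indicator (L v) y)"
      by (simp add: sum.reindex[OF inj] c_L)
    also have "\<dots> = (\<Sum>v\<in>V. if v = f y then (if y \<in> space Y then v else 0) else 0)"
      by (intro sum.cong) (auto simp: L_def indicator_def)
    also have "\<dots> = (if f y \<in> V \<and> y \<in> space Y then f y else 0)"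
      by (simp add: sum.delta[OF V])
    also have "\<dots> = f y" using f by (auto simp: V_def)
    finally show ?thesis by simp
  qed
  show "f \<in> simple_functions Y"
    unfolding simple_functions_def
  proof (intro CollectI exI conjI ballI)
    show "finite (L ` V)" using V by simp
    show "f = (\<lambda>y. \<Sum>E\<in>L ` V. c E * indicator E y)" by (rule ext) (rule f_eq)
    fix E assume "E \<in> L ` V"
    then obtain v where v: "v \<in> V" "E = L v" by auto
    show E: "E \<in> sets Y" unfolding v(2) L_def using f by (intro simple_functionD(2)) simp
    have "emeasure Y E \<le> emeasure Y {y \<in> space Y. f y \<noteq> 0}"
    proof (rule emeasure_mono)
      show "E \<subseteq> {y \<in> space Y. f y \<noteq> 0}" using v by (auto simp: L_def V_def)
      have [measurable]: "f \<in> borel_measurable Y" using f by (simp add: borel_measurable_simple_function)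
      show "{y \<in> space Y. f y \<noteq> 0} \<in> sets Y" by measurable
    qed
    also have "\<dots> < \<infinity>" using f by simp
    finally show "emeasure Y E < \<infinity>" .
  qed
qed

lemma simple_functions_combine:
  assumes f: "f \<in> simple_functions Y" and g: "g \<in> simple_functions Y" and \<phi>: "\<phi> 0 0 = 0"
  shows "(\<lambda>y. \<phi> (f y) (g y)) \<in> simple_functions Y"
  unfolding simple_functions_iff
proof (intro conjI allI impI)
  have f': "simple_function Y f" "emeasure Y {y \<in> space Y. f y \<noteq> 0} < \<infinity>"
    and g': "simple_function Y g" "emeasure Y {y \<in> space Y. g y \<noteq> 0} < \<infinity>"
    using f g by (auto simp: simple_functions_iff)
  note [measurable] = f'(1)[THEN borel_measurable_simple_function] g'(1)[THEN borel_measurable_simple_function]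
  show "simple_function Y (\<lambda>y. \<phi> (f y) (g y))" using f'(1) g'(1) by (rule simple_function_compose2)
  have "emeasure Y {y \<in> space Y. \<phi> (f y) (g y) \<noteq> 0}
      \<le> emeasure Y ({y \<in> space Y. f y \<noteq> 0} \<union> {y \<in> space Y. g y \<noteq> 0})"
    using \<phi> by (intro emeasure_mono) auto
  also have "\<dots> \<le> emeasure Y {y \<in> space Y. f y \<noteq> 0} + emeasure Y {y \<in> space Y. g y \<noteq> 0}"
    by (rule emeasure_subadditive) auto
  also have "\<dots> < \<infinity>" using f'(2) g'(2) by simp
  finally show "emeasure Y {y \<in> space Y. \<phi> (f y) (g y) \<noteq> 0} < \<infinity>" .
  show "\<phi> (f y) (g y) = 0" if "y \<notin> space Y" for y
    using f g \<phi> that by (simp add: simple_functions_iff)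
qed

lemma simple_functions_scale: "f \<in> simple_functions Y \<Longrightarrow> (\<lambda>y. c * f y) \<in> simple_functions Y"
  using simple_functions_combine[of f Y f "\<lambda>a b. c * a"] by simp

lemma simple_functions_abs: "f \<in> simple_functions Y \<Longrightarrow> (\<lambda>y. \<bar>f y\<bar>) \<in> simple_functions Y"
  using simple_functions_combine[of f Y f "\<lambda>a b. \<bar>a\<bar>"] by simp

lemma simple_functions_add:
  "f \<in> simple_functions Y \<Longrightarrow> g \<in> simple_functions Y \<Longrightarrow> (\<lambda>y. f y + g y) \<in> simple_functions Y"
  using simple_functions_combine[of f Y g "(+)"] by simp

lemma simple_functions_zero: "(\<lambda>y. 0) \<in> simple_functions Y"
  by (auto simp: simple_functions_def intro!: exI[of _ "{}"])

lemma simple_functions_measurable: "f \<in> simple_functions Y \<Longrightarrow> f \<in> borel_measurable Y"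
  by (auto simp: simple_functions_iff dest: borel_measurable_simple_function)

lemma simple_functions_integrable:
  assumes f: "f \<in> simple_functions Y"
  shows "integrable Y f"
proof -
  have "simple_function Y f" "emeasure Y {y \<in> space Y. f y \<noteq> 0} \<noteq> \<infinity>"
    using f by (auto simp: simple_functions_iff)
  then have "Bochner_Integration.simple_bochner_integrable Y f"
    by (auto simp: simple_bochner_integrable.simps)
  then show ?thesis
    by (auto simp: integrable.simps intro: has_bochner_integral_simple_bochner_integrable)
qed

lemma simple_functions_powr_integrable:
  assumes "f \<in> simple_functions Y"
  shows "integrable Y (\<lambda>y. \<bar>f y\<bar> powr r)"
  using simple_functions_integrable[OF simple_functions_combine[OF assms assms, of "\<lambda>a b. \<bar>a\<bar> powr r"]] by simp

section \<open>The Lebesgue norms on simple functions\<close>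

lemma Lp_norm_nonneg: "0 \<le> Lp_norm p Y f"
  by (simp add: Lp_norm_def)

lemma Lp_norm_abs: "Lp_norm p Y (\<lambda>y. \<bar>f y\<bar>) = Lp_norm p Y f"
  by (simp add: Lp_norm_def)

text \<open>The norm is defined by \<open>enn2real\<close>, which sends \<open>\<infinity>\<close> to \<open>0\<close>; the equivalence holds because simple
  functions are bounded.\<close>

lemma Lp_norm_top_le_iff:
  assumes f: "f \<in> simple_functions Y" and r: "0 \<le> r"
  shows "Lp_norm \<infinity> Y f \<le> r \<longleftrightarrow> (AE y in Y. \<bar>f y\<bar> \<le> r)"
proof -
  note [measurable] = simple_functions_measurable[OF f]
  define e where "e = esssup Y (\<lambda>y. ennreal \<bar>f y\<bar>)"
  have "finite (f ` space Y)" using f by (auto simp: simple_functions_iff dest: simple_functionD)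
  then have "bdd_above ((\<lambda>v. \<bar>v\<bar>) ` f ` space Y)" by (rule bdd_above_finite[OF finite_imageI])
  then obtain b where "\<And>y. y \<in> space Y \<Longrightarrow> \<bar>f y\<bar> \<le> b" by (auto simp: bdd_above_def)
  then have "e \<le> ennreal b" unfolding e_def by (intro esssup_I AE_I2 ennreal_leI) auto
  then have e: "e < top" by (metis ennreal_less_top order_le_less_trans)
  have "Lp_norm \<infinity> Y f \<le> r \<longleftrightarrow> e \<le> ennreal r"
  proof -
    obtain e' where "0 \<le> e'" "e = ennreal e'" using e by (cases e) auto
    then show ?thesis using r by (simp add: Lp_norm_def e_def[symmetric])
  qed
  also have "\<dots> \<longleftrightarrow> (AE y in Y. ennreal \<bar>f y\<bar> \<le> ennreal r)"
  proof
    assume "e \<le> ennreal r"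
    with esssup_AE[of "\<lambda>y. ennreal \<bar>f y\<bar>" Y] show "AE y in Y. ennreal \<bar>f y\<bar> \<le> ennreal r"
      unfolding e_def by (auto elim!: eventually_mono)
  qed (auto simp: e_def intro!: esssup_I)
  also have "\<dots> \<longleftrightarrow> (AE y in Y. \<bar>f y\<bar> \<le> r)" using r by simp
  finally show ?thesis .
qed

lemma Lp_norm_finite_le_iff:
  assumes p: "1 \<le> p" "p \<noteq> \<infinity>" and r: "0 \<le> r"
  shows "Lp_norm p Y f \<le> r \<longleftrightarrow> (\<integral>y. \<bar>f y\<bar> powr enn2real p \<partial>Y) \<le> r powr enn2real p"
proof -
  define q where "q = enn2real p"
  have "enn2real 1 \<le> q" unfolding q_def using p by (intro enn2real_mono) (auto simp: less_top)
  then have q: "0 < q" by simp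
  define J where "J = (\<integral>y. \<bar>f y\<bar> powr q \<partial>Y)"
  have J: "0 \<le> J" by (simp add: J_def)
  have "J powr (1 / q) \<le> r \<longleftrightarrow> J \<le> r powr q"
  proof
    assume "J powr (1 / q) \<le> r"
    then have "(J powr (1 / q)) powr q \<le> r powr q" using q by (intro powr_mono2) auto
    then show "J \<le> r powr q" using q J by (simp add: powr_powr)
  next
    assume "J \<le> r powr q"
    then have "J powr (1 / q) \<le> (r powr q) powr (1 / q)" using q J by (intro powr_mono2) auto
    then show "J powr (1 / q) \<le> r" using q r by (simp add: powr_powr)
  qed
  then show ?thesis using p by (simp add: Lp_norm_def q_def J_def)
qed

text \<open>Convexity of the power function on the closed half-line: at an endpoint \<open>0\<close> it reduces to
  \<open>t powr q \<le> t\<close> for \<open>t\<close> between \<open>0\<close> and \<open>1\<close>.\<close>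

lemma powr_convex_combination:
  fixes a b s q :: real
  assumes q: "1 \<le> q" and ab: "0 \<le> a" "0 \<le> b" and s: "0 \<le> s" "s \<le> 1"
  shows "((1 - s) * a + s * b) powr q \<le> (1 - s) * a powr q + s * b powr q"
proof (cases "0 < a \<and> 0 < b")
  case True
  then show ?thesis
    using convex_onD[OF powr_convex[OF q], of s a b] s by simp
next
  case False
  have "t powr q \<le> t" if "0 \<le> t" "t \<le> 1" for t :: real
    using powr_mono'[of 1 q t] q that by simp
  then have "(t * c) powr q \<le> t * c powr q" if "0 \<le> t" "t \<le> 1" "0 \<le> c" for t c :: real
    using that by (simp add: powr_mult mult_right_mono)
  from this[of "1 - s" a] this[of s b] show ?thesis
    using False ab s by (auto simp: not_less)
qed

text \<open>For \<open>p = \<infinity>\<close> the bound holds pointwise. For finite \<open>p\<close> the unit ball is a sublevel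
  set of \<open>\<integral> \<bar>f\<bar> powr p\<close>, which is convex because the integrand is.\<close>

lemma Lp_unit_ball_convex:
  assumes f: "f \<in> simple_functions Y" and g: "g \<in> simple_functions Y" and p: "1 \<le> p"
    and norms: "Lp_norm p Y f \<le> 1" "Lp_norm p Y g \<le> 1" and s: "0 \<le> s" "s \<le> 1"
  shows "Lp_norm p Y (\<lambda>y. (1 - s) * f y + s * g y) \<le> 1"
proof -
  have h: "(\<lambda>y. (1 - s) * f y + s * g y) \<in> simple_functions Y"
    by (intro simple_functions_add simple_functions_scale f g)
  have abs_le: "\<bar>(1 - s) * a + s * b\<bar> \<le> (1 - s) * \<bar>a\<bar> + s * \<bar>b\<bar>" for a b
    using s abs_triangle_ineq[of "(1 - s) * a" "s * b"] by (simp add: abs_mult)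
  show ?thesis
  proof (cases "p = \<infinity>")
    case True
    have "AE y in Y. \<bar>f y\<bar> \<le> 1" "AE y in Y. \<bar>g y\<bar> \<le> 1"
      using norms f g unfolding True by (simp_all only: Lp_norm_top_le_iff zero_le_one)
    then have "AE y in Y. \<bar>(1 - s) * f y + s * g y\<bar> \<le> 1"
    proof eventually_elim
      case (elim y)
      have "(1 - s) * \<bar>f y\<bar> + s * \<bar>g y\<bar> \<le> 1"
        using elim s by (intro convex_bound_le) auto
      with abs_le[of "f y" "g y"] show ?case by linarith
    qed
    then show ?thesis unfolding True Lp_norm_top_le_iff[OF h zero_le_one] .
  next
    case False
    define q where "q = enn2real p"
    have "enn2real 1 \<le> q" unfolding q_def using p False by (intro enn2real_mono) (auto simp: less_top)
    then have q: "1 \<le> q" by simp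
    have le: "\<bar>(1 - s) * a + s * b\<bar> powr q \<le> (1 - s) * \<bar>a\<bar> powr q + s * \<bar>b\<bar> powr q" for a b
    proof -
      have "\<bar>(1 - s) * a + s * b\<bar> powr q \<le> ((1 - s) * \<bar>a\<bar> + s * \<bar>b\<bar>) powr q"
        using abs_le q by (intro powr_mono2) auto
      also have "\<dots> \<le> (1 - s) * \<bar>a\<bar> powr q + s * \<bar>b\<bar> powr q"
        by (rule powr_convex_combination) (use q s in auto)
      finally show ?thesis .
    qed
    have "(\<integral>y. \<bar>(1 - s) * f y + s * g y\<bar> powr q \<partial>Y) \<le> (\<integral>y. (1 - s) * \<bar>f y\<bar> powr q + s * \<bar>g y\<bar> powr q \<partial>Y)"
      using le simple_functions_powr_integrable f g h
      by (intro integral_mono Bochner_Integration.integrable_add integrable_mult_right) auto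
    also have "\<dots> = (1 - s) * (\<integral>y. \<bar>f y\<bar> powr q \<partial>Y) + s * (\<integral>y. \<bar>g y\<bar> powr q \<partial>Y)"
      using simple_functions_powr_integrable[OF f] simple_functions_powr_integrable[OF g] by simp
    also have "\<dots> \<le> 1"
      using norms s unfolding Lp_norm_finite_le_iff[OF p False zero_le_one] q_def
      by (intro convex_bound_le) auto
    finally show ?thesis unfolding Lp_norm_finite_le_iff[OF p False zero_le_one] q_def by simp
  qed
qed

lemma Lp_norm_scale_le_1:
  assumes f: "f \<in> simple_functions Y" and p: "1 \<le> p" and r: "0 < r" "Lp_norm p Y f \<le> r"
  shows "Lp_norm p Y (\<lambda>y. 1 / r * f y) \<le> 1"
proof (cases "p = \<infinity>")
  case True
  have "AE y in Y. \<bar>f y\<bar> \<le> r" using Lp_norm_top_le_iff[OF f, of r] r True by auto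
  then have "AE y in Y. \<bar>1 / r * f y\<bar> \<le> 1"
    by eventually_elim (use r in \<open>simp add: abs_mult\<close>)
  then show ?thesis unfolding True Lp_norm_top_le_iff[OF simple_functions_scale[OF f] zero_le_one] .
next
  case False
  have "(\<integral>y. \<bar>f y\<bar> powr enn2real p \<partial>Y) \<le> r powr enn2real p"
    using r Lp_norm_finite_le_iff[OF p False, of r Y f] by simp
  moreover have "(\<integral>y. \<bar>1 / r * f y\<bar> powr enn2real p \<partial>Y) = (\<integral>y. \<bar>f y\<bar> powr enn2real p \<partial>Y) / r powr enn2real p"
    using r by (simp add: abs_mult powr_divide)
  ultimately show ?thesis
    unfolding Lp_norm_finite_le_iff[OF p False zero_le_one] using r by simp
qed

section \<open>Factorisation for positive operators\<close>

text \<open>The weight \<open>w\<close> turns the \<open>\<sigma>\<close>-finite measure of \<open>X\<close> into a finite measure with the same null sets.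
  Dividing the functions \<open>T j f\<close> by \<open>w\<close> compensates for it: both the geometric mean and the pairing
  with \<open>g j\<close> are homogeneous of degree one in them, so no integral changes.\<close>

theorem theorem1p4:
  fixes X :: "'a measure"
    and d :: nat
    and Y :: "nat \<Rightarrow> 'b measure"
    and T :: "nat \<Rightarrow> ('b \<Rightarrow> real) \<Rightarrow> 'a \<Rightarrow> real"
    and p :: "nat \<Rightarrow> ennreal"
    and \<alpha> :: "nat \<Rightarrow> real"
    and A :: real
  assumes "sigma_finite_measure X"
    and "\<And>j. j \<in> {1..d} \<Longrightarrow> linear_operator (Y j) X (T j)"
    and "\<And>j. j \<in> {1..d} \<Longrightarrow> positive_operator (Y j) X (T j)"
    and "\<And>j. j \<in> {1..d} \<Longrightarrow> saturates (Y j) X (T j)"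
    and "\<And>j. j \<in> {1..d} \<Longrightarrow> 1 \<le> p j"
    and "\<And>j. j \<in> {1..d} \<Longrightarrow> 0 < \<alpha> j"
    and "(\<Sum>j=1..d. \<alpha> j) = 1"
    and "0 \<le> A"
    and "\<And>f :: nat \<Rightarrow> 'b \<Rightarrow> real.
           (\<And>j. j \<in> {1..d} \<Longrightarrow> f j \<in> simple_functions (Y j) \<and> (\<forall>y\<in>space (Y j). 0 \<le> f j y)) \<Longrightarrow>
           (\<integral>\<^sup>+x. ennreal (\<Prod>j=1..d. T j (f j) x powr \<alpha> j) \<partial>X)
             \<le> ennreal (A * (\<Prod>j=1..d. Lp_norm (p j) (Y j) (f j) powr \<alpha> j))"
  shows "\<exists>g :: nat \<Rightarrow> 'a \<Rightarrow> real.
           (\<forall>j\<in>{1..d}. g j \<in> borel_measurable X \<and> (\<forall>x\<in>space X. 0 \<le> g j x)) \<and>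
           (AE x in X. 1 \<le> (\<Prod>j=1..d. g j x powr \<alpha> j)) \<and>
           (\<forall>j\<in>{1..d}. \<forall>f\<in>simple_functions (Y j).
              integrable X (\<lambda>x. g j x * T j f x) \<and>
              (\<integral>x. g j x * T j f x \<partial>X) \<le> A * Lp_norm (p j) (Y j) f)"
proof -
  interpret X: sigma_finite_measure X by fact
  interpret convex_weights "{1..d}" \<alpha>
    by unfold_locales (use assms(6,7) in auto)
  note lin = assms(2)[unfolded linear_operator_def]
  have T_meas: "T j f \<in> borel_measurable X" if "j \<in> {1..d}" "f \<in> simple_functions (Y j)" for j f
    using lin[OF that(1)] that(2) by blast
  have T_add: "AE x in X. T j (\<lambda>y. f y + g y) x = T j f x + T j g x"
    if "j \<in> {1..d}" "f \<in> simple_functions (Y j)" "g \<in> simple_functions (Y j)" for j f g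
    using lin[OF that(1)] that(2,3) by blast
  have T_scale: "AE x in X. T j (\<lambda>y. c * f y) x = c * T j f x"
    if "j \<in> {1..d}" "f \<in> simple_functions (Y j)" for j f c
    using lin[OF that(1)] that(2) by blast
  have T_pos: "AE x in X. 0 \<le> T j f x"
    if "j \<in> {1..d}" "f \<in> simple_functions (Y j)" "\<forall>y\<in>space (Y j). 0 \<le> f y" for j f
    using assms(3)[OF that(1)] that(2,3) unfolding positive_operator_def by auto
  obtain w :: "'a \<Rightarrow> real" where w [measurable]: "w \<in> borel_measurable X"
    and w_pos: "\<And>x. 0 < w x" and w_int: "integrable X w"
    using X.obtain_positive_integrable_function by metis
  define M where "M = density X (\<lambda>x. ennreal (w x))"
  have M_sets [simp]: "sets M = sets X" and M_meas [simp]: "borel_measurable M = borel_measurable X"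
    by (simp add: M_def) (rule measurable_cong_sets, simp_all add: M_def)
  have M_nn: "(\<integral>\<^sup>+x. f x \<partial>M) = (\<integral>\<^sup>+x. ennreal (w x) * f x \<partial>X)" if "f \<in> borel_measurable X" for f
    unfolding M_def using that by (subst nn_integral_density) auto
  have M_AE: "(AE x in M. P x) \<longleftrightarrow> (AE x in X. P x)" for P
    unfolding M_def using w_pos by (subst AE_density) auto
  have M_null: "emeasure M E = 0 \<longleftrightarrow> emeasure X E = 0" if "E \<in> sets X" for E
    using that AE_iff_null_sets[of E M] AE_iff_null_sets[of E X] M_AE[of "\<lambda>x. x \<notin> E"]
    by (auto simp: null_sets_def)
  define K where "K j = {u \<in> borel_measurable X. (\<forall>x. 0 \<le> u x) \<and>
      (\<exists>f\<in>simple_functions (Y j). (\<forall>y\<in>space (Y j). 0 \<le> f y) \<and> Lp_norm (p j) (Y j) f \<le> 1 \<and>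
        (AE x in X. w x * u x = T j f x))}" for j
  have K_I: "(\<lambda>x. max 0 (T j f x) / w x) \<in> K j"
      and K_I_eq: "AE x in X. w x * (max 0 (T j f x) / w x) = T j f x"
    if j: "j \<in> {1..d}" and f: "f \<in> simple_functions (Y j)" "\<forall>y\<in>space (Y j). 0 \<le> f y"
      and norm: "Lp_norm (p j) (Y j) f \<le> 1" for j f
  proof -
    note [measurable] = T_meas[OF j f(1)]
    show eq: "AE x in X. w x * (max 0 (T j f x) / w x) = T j f x"
      using T_pos[OF j f] by eventually_elim (use w_pos in \<open>simp add: less_imp_neq[THEN not_sym]\<close>)
    show "(\<lambda>x. max 0 (T j f x) / w x) \<in> K j"
      unfolding K_def using f norm eq w_pos by (auto simp: less_imp_le intro!: bexI[of _ f])
  qed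
  interpret M_finite: finite_measure M
  proof (rule finite_measureI)
    have "emeasure M (space M) = (\<integral>\<^sup>+x. ennreal (w x) \<partial>X)"
      using M_nn[of "\<lambda>_. 1"] by simp
    also have "\<dots> = ennreal (\<integral>x. w x \<partial>X)"
      using w_int w_pos by (intro nn_integral_eq_integral) (auto simp: less_imp_le)
    finally show "emeasure M (space M) \<noteq> \<infinity>" by simp
  qed
  interpret convex_families "{1..d}" \<alpha> M K A
  proof
    fix j u v and s :: real
    assume j: "j \<in> {1..d}" and u: "u \<in> K j" and v: "v \<in> K j" and s: "0 \<le> s" "s \<le> 1"
    obtain f g where f: "f \<in> simple_functions (Y j)" "\<forall>y\<in>space (Y j). 0 \<le> f y" "Lp_norm (p j) (Y j) f \<le> 1"
        "AE x in X. w x * u x = T j f x"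
      and g: "g \<in> simple_functions (Y j)" "\<forall>y\<in>space (Y j). 0 \<le> g y" "Lp_norm (p j) (Y j) g \<le> 1"
        "AE x in X. w x * v x = T j g x"
      using u v by (auto simp: K_def)
    have uv [measurable]: "u \<in> borel_measurable X" "v \<in> borel_measurable X" and uv0: "0 \<le> u x" "0 \<le> v x" for x
      using u v by (auto simp: K_def)
    have "AE x in X. w x * ((1 - s) * u x + s * v x) = T j (\<lambda>y. (1 - s) * f y + s * g y) x"
      using T_add[OF j simple_functions_scale[OF f(1)] simple_functions_scale[OF g(1)], of "1 - s" s]
        T_scale[OF j f(1), of "1 - s"] T_scale[OF j g(1), of s] f(4) g(4)
      by eventually_elim (simp add: distrib_left mult.left_commute)
    moreover have "(\<lambda>y. (1 - s) * f y + s * g y) \<in> simple_functions (Y j)"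
      by (intro simple_functions_add simple_functions_scale f g)
    moreover have "Lp_norm (p j) (Y j) (\<lambda>y. (1 - s) * f y + s * g y) \<le> 1"
      by (rule Lp_unit_ball_convex[OF f(1) g(1) assms(5)[OF j] f(3) g(3) s])
    moreover have "\<forall>y\<in>space (Y j). 0 \<le> (1 - s) * f y + s * g y"
      using f(2) g(2) s by auto
    ultimately show "(\<lambda>x. (1 - s) * u x + s * v x) \<in> K j"
      unfolding K_def using uv0 s by (intro CollectI conjI bexI allI) auto
  next
    fix u :: "nat \<Rightarrow> 'a \<Rightarrow> real" assume u: "\<And>j. j \<in> {1..d} \<Longrightarrow> u j \<in> K j"
    then have u_meas [measurable]: "u j \<in> borel_measurable X" and u0: "0 \<le> u j x" if "j \<in> {1..d}" for j x
      using that by (auto simp: K_def)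
    have "\<forall>j\<in>{1..d}. \<exists>f. f \<in> simple_functions (Y j) \<and> (\<forall>y\<in>space (Y j). 0 \<le> f y) \<and>
        Lp_norm (p j) (Y j) f \<le> 1 \<and> (AE x in X. w x * u j x = T j f x)"
      using u unfolding K_def by blast
    from bchoice[OF this] obtain f where f: "\<And>j. j \<in> {1..d} \<Longrightarrow> f j \<in> simple_functions (Y j) \<and>
        (\<forall>y\<in>space (Y j). 0 \<le> f j y)" "\<And>j. j \<in> {1..d} \<Longrightarrow> Lp_norm (p j) (Y j) (f j) \<le> 1"
        "\<And>j. j \<in> {1..d} \<Longrightarrow> AE x in X. w x * u j x = T j (f j) x"
      by blast
    have "(\<integral>\<^sup>+x. ennreal (gmean (\<lambda>j. u j x)) \<partial>M) = (\<integral>\<^sup>+x. ennreal (w x) * ennreal (gmean (\<lambda>j. u j x)) \<partial>X)"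
      by (rule M_nn) measurable
    also have "\<dots> = (\<integral>\<^sup>+x. ennreal (\<Prod>j=1..d. T j (f j) x powr \<alpha> j) \<partial>X)"
    proof (rule nn_integral_cong_AE)
      have "AE x in X. \<forall>j\<in>{1..d}. w x * u j x = T j (f j) x"
        by (rule AE_finite_allI) (use f(3) in auto)
      then show "AE x in X. ennreal (w x) * ennreal (gmean (\<lambda>j. u j x)) = ennreal (\<Prod>j=1..d. T j (f j) x powr \<alpha> j)"
      proof eventually_elim
        case (elim x)
        have "ennreal (w x) * ennreal (gmean (\<lambda>j. u j x)) = ennreal (w x * gmean (\<lambda>j. u j x))"
          using w_pos[of x] gmean_nonneg by (simp add: ennreal_mult less_imp_le)
        also have "w x * gmean (\<lambda>j. u j x) = gmean (\<lambda>j. w x * u j x)"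
          using w_pos u0 by (intro gmean_scale[symmetric]) auto
        also have "\<dots> = (\<Prod>j=1..d. T j (f j) x powr \<alpha> j)"
          unfolding gmean_def using elim by (intro prod.cong) auto
        finally show ?case .
      qed
    qed
    also have "\<dots> \<le> ennreal (A * (\<Prod>j=1..d. Lp_norm (p j) (Y j) (f j) powr \<alpha> j))"
      by (rule assms(9)) (rule f(1))
    also have "\<dots> \<le> ennreal A"
    proof (rule ennreal_leI)
      have "(\<Prod>j=1..d. Lp_norm (p j) (Y j) (f j) powr \<alpha> j) \<le> 1"
        using f(2) weight_pos by (intro prod_le_1 conjI powr_le1) (auto simp: less_imp_le abs_of_nonneg Lp_norm_nonneg)
      then show "A * (\<Prod>j=1..d. Lp_norm (p j) (Y j) (f j) powr \<alpha> j) \<le> A"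
        using assms(8) by (simp add: mult_left_le)
    qed
    finally show "(\<integral>\<^sup>+x. ennreal (gmean (\<lambda>j. u j x)) \<partial>M) \<le> ennreal A" .
  qed (use assms(8) in \<open>auto simp: K_def\<close>)
  have K_ne: "K j \<noteq> {}" if j: "j \<in> {1..d}" for j
  proof -
    have "Lp_norm (p j) (Y j) (\<lambda>y. 0) \<le> 1"
      using Lp_norm_scale_le_1[OF simple_functions_zero[of "Y j"] assms(5)[OF j], of "Lp_norm (p j) (Y j) (\<lambda>y. 0) + 1"]
        Lp_norm_nonneg[of "p j" "Y j" "\<lambda>y. 0"] by simp
    then show ?thesis using K_I[OF j simple_functions_zero] by auto
  qed
  have K_sat: "\<exists>E'\<in>sets M. E' \<subseteq> E \<and> 0 < emeasure M E' \<and> (\<exists>h\<in>K j. AE x in M. x \<in> E' \<longrightarrow> 0 < h x)"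
    if j: "j \<in> {1..d}" and E: "E \<in> sets M" "0 < emeasure M E" for j E
  proof -
    have "0 < emeasure X E" using E M_null[of E] by (simp add: zero_less_iff_neq_zero)
    then obtain E' h where E': "E' \<in> sets X" "E' \<subseteq> E" "0 < emeasure X E'"
      and h: "h \<in> simple_functions (Y j)" "\<forall>y\<in>space (Y j). 0 \<le> h y" "AE x in X. x \<in> E' \<longrightarrow> 0 < T j h x"
      using assms(4)[OF j] E(1) unfolding saturates_def by (auto; blast)
    define r where "r = Lp_norm (p j) (Y j) h + 1"
    have r: "0 < r" "Lp_norm (p j) (Y j) h \<le> r"
      using Lp_norm_nonneg[of "p j" "Y j" h] by (auto simp: r_def)
    define f where "f = (\<lambda>y. 1 / r * h y)"
    have f: "f \<in> simple_functions (Y j)" "\<forall>y\<in>space (Y j). 0 \<le> f y" "Lp_norm (p j) (Y j) f \<le> 1"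
      unfolding f_def using h r by (auto intro!: simple_functions_scale Lp_norm_scale_le_1 assms(5) j simp del: times_divide_eq_left)
    have "AE x in M. x \<in> E' \<longrightarrow> 0 < max 0 (T j f x) / w x"
      unfolding M_AE using h(3) T_scale[OF j h(1), of "1 / r"]
      by eventually_elim (use r w_pos in \<open>auto simp: f_def less_max_iff_disj\<close>)
    moreover have "0 < emeasure M E'"
      using E'(3) M_null[OF E'(1)] by (simp add: zero_less_iff_neq_zero)
    ultimately show ?thesis
      using E'(1,2) K_I[OF j f] by (intro bexI[of _ E'] conjI bexI[of _ "\<lambda>x. max 0 (T j f x) / w x"]) simp_all
  qed
  obtain g where g: "\<And>j. j \<in> {1..d} \<Longrightarrow> g j \<in> borel_measurable M" "\<And>j x. 0 \<le> g j x"
    "\<And>j v. j \<in> {1..d} \<Longrightarrow> v \<in> K j \<Longrightarrow> (\<integral>\<^sup>+x. ennreal (g j x * v x) \<partial>M) \<le> ennreal A"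
    "AE x in M. 1 \<le> gmean (\<lambda>j. g j x)"
    by (rule factorisation, erule K_ne, erule (2) K_sat) (rule that)
  have g_meas [measurable]: "g j \<in> borel_measurable X" if "j \<in> {1..d}" for j using g(1)[OF that] by simp
  have bound: "(\<integral>\<^sup>+x. ennreal (g j x * T j f x) \<partial>X) \<le> ennreal (A * Lp_norm (p j) (Y j) f)"
    if j: "j \<in> {1..d}" and f: "f \<in> simple_functions (Y j)" "\<forall>y\<in>space (Y j). 0 \<le> f y" for j f
  proof -
    define N where "N = Lp_norm (p j) (Y j) f"
    have N: "0 \<le> N" by (simp add: N_def Lp_norm_nonneg)
    note [measurable] = g_meas[OF j] T_meas[OF j f(1)]
    \<comment> \<open>Scaling by any \<open>r > 0\<close> above the norm, rather than by the norm, includes functions of norm zero.\<close>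
    have le: "(\<integral>\<^sup>+x. ennreal (g j x * T j f x) \<partial>X) \<le> ennreal (A * r)" if r: "0 < r" "N \<le> r" for r
    proof -
      define u where "u = (\<lambda>y. 1 / r * f y)"
      have u: "u \<in> simple_functions (Y j)" "\<forall>y\<in>space (Y j). 0 \<le> u y" "Lp_norm (p j) (Y j) u \<le> 1"
        unfolding u_def using f r by (auto intro!: simple_functions_scale Lp_norm_scale_le_1 assms(5) j simp: N_def simp del: times_divide_eq_left)
      define v where "v = (\<lambda>x. max 0 (T j u x) / w x)"
      have vK: "v \<in> K j" and v_eq: "AE x in X. w x * v x = T j u x"
        unfolding v_def by (rule K_I[OF j u], rule K_I_eq[OF j u])
      have [measurable]: "v \<in> borel_measurable X" and v0: "\<And>x. 0 \<le> v x" using vK by (auto simp: K_def)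
      have "(\<integral>\<^sup>+x. ennreal (g j x * T j f x) \<partial>X) = (\<integral>\<^sup>+x. ennreal r * (ennreal (w x) * ennreal (g j x * v x)) \<partial>X)"
      proof (rule nn_integral_cong_AE)
        show "AE x in X. ennreal (g j x * T j f x) = ennreal r * (ennreal (w x) * ennreal (g j x * v x))"
          using v_eq T_scale[OF j f(1), of "1 / r"]
        proof eventually_elim
          case (elim x)
          have "T j f x = r * (w x * v x)" using elim r by (simp add: u_def)
          then have *: "g j x * T j f x = r * (w x * (g j x * v x))" by (simp add: mult_ac)
          show ?case
            unfolding * using r w_pos[of x] g(2)[of j x] v0[of x] by (simp add: ennreal_mult less_imp_le)
        qed
      qed
      also have "\<dots> = ennreal r * (\<integral>\<^sup>+x. ennreal (w x) * ennreal (g j x * v x) \<partial>X)"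
        by (rule nn_integral_cmult) measurable
      also have "(\<integral>\<^sup>+x. ennreal (w x) * ennreal (g j x * v x) \<partial>X) = (\<integral>\<^sup>+x. ennreal (g j x * v x) \<partial>M)"
        by (rule M_nn[symmetric]) measurable
      also have "ennreal r * \<dots> \<le> ennreal r * ennreal A"
        by (intro mult_left_mono g(3) j vK) simp
      also have "\<dots> = ennreal (A * r)" using r assms(8) by (simp add: ennreal_mult mult.commute)
      finally show ?thesis .
    qed
    have "(\<lambda>n. ennreal (A * (N + inverse (real (Suc n))))) \<longlonglongrightarrow> ennreal (A * N)"
      by (intro tendsto_ennrealI tendsto_mult tendsto_const LIMSEQ_inverse_real_of_nat_add)
    then show ?thesis
      unfolding N_def[symmetric]
    proof (rule LIMSEQ_le_const, intro exI allI impI)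
      fix n
      have "0 < inverse (real (Suc n))" by simp
      with N show "(\<integral>\<^sup>+x. ennreal (g j x * T j f x) \<partial>X) \<le> ennreal (A * (N + inverse (real (Suc n))))"
        by (intro le) linarith+
    qed
  qed
  show ?thesis
  proof (intro exI[of _ g] conjI ballI)
    show "g j \<in> borel_measurable X" if "j \<in> {1..d}" for j by (rule g_meas[OF that])
    show "0 \<le> g j x" for j x by (rule g(2))
    show "AE x in X. 1 \<le> (\<Prod>j=1..d. g j x powr \<alpha> j)"
      using g(4) unfolding M_AE gmean_def .
    fix j f assume j: "j \<in> {1..d}" and f: "f \<in> simple_functions (Y j)"
    define h where "h = (\<lambda>y. \<bar>f y\<bar>)"
    have h: "h \<in> simple_functions (Y j)" "\<forall>y\<in>space (Y j). 0 \<le> h y"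
      unfolding h_def using f by (auto intro: simple_functions_abs)
    note [measurable] = g_meas[OF j] T_meas[OF j f] T_meas[OF j h(1)]
    have Tf_le: "AE x in X. \<bar>T j f x\<bar> \<le> T j h x"
    proof -
      have "AE x in X. 0 \<le> T j (\<lambda>y. h y + c * f y) x" if "\<bar>c\<bar> = 1" for c
      proof (rule T_pos[OF j])
        show "(\<lambda>y. h y + c * f y) \<in> simple_functions (Y j)"
          by (intro simple_functions_add simple_functions_scale h f)
        show "\<forall>y\<in>space (Y j). 0 \<le> h y + c * f y"
          using that by (auto simp: h_def abs_if split: if_splits)
      qed
      from this[of 1] this[of "-1"]
      have "AE x in X. 0 \<le> T j (\<lambda>y. h y + 1 * f y) x" "AE x in X. 0 \<le> T j (\<lambda>y. h y + (-1) * f y) x"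
        by simp_all
      then show ?thesis
        using T_add[OF j h(1) simple_functions_scale[OF f], of 1] T_scale[OF j f, of 1]
          T_add[OF j h(1) simple_functions_scale[OF f], of "-1"] T_scale[OF j f, of "-1"]
        by eventually_elim auto
    qed
    have h_bound: "(\<integral>\<^sup>+x. ennreal (g j x * T j h x) \<partial>X) \<le> ennreal (A * Lp_norm (p j) (Y j) f)"
      using bound[OF j h] by (simp add: h_def Lp_norm_abs)
    have T_h0: "AE x in X. 0 \<le> g j x * T j h x"
      using Tf_le by eventually_elim (use g(2) in \<open>auto intro!: mult_nonneg_nonneg\<close>)
    have int_h: "integrable X (\<lambda>x. g j x * T j h x)"
      by (rule integrableI_nonneg) (use T_h0 h_bound in \<open>auto intro: order_le_less_trans\<close>)
    have le: "AE x in X. \<bar>g j x * T j f x\<bar> \<le> g j x * T j h x"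
      using Tf_le by eventually_elim (use g(2) in \<open>auto simp: abs_mult intro!: mult_left_mono\<close>)
    show int_f: "integrable X (\<lambda>x. g j x * T j f x)"
      by (rule Bochner_Integration.integrable_bound[OF int_h]) (use le in \<open>auto elim!: eventually_mono\<close>)
    have "(\<integral>x. g j x * T j f x \<partial>X) \<le> (\<integral>x. g j x * T j h x \<partial>X)"
      using le by (intro integral_mono_AE int_f int_h) (auto elim!: eventually_mono)
    also have "\<dots> \<le> A * Lp_norm (p j) (Y j) f"
    proof -
      have "ennreal (\<integral>x. g j x * T j h x \<partial>X) \<le> ennreal (A * Lp_norm (p j) (Y j) f)"
        using h_bound nn_integral_eq_integral[OF int_h T_h0] by simp
      then show ?thesis
        using assms(8) by (subst (asm) ennreal_le_iff) (auto simp: Lp_norm_nonneg)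
    qed
    finally show "(\<integral>x. g j x * T j f x \<partial>X) \<le> A * Lp_norm (p j) (Y j) f" .
  qed
qed

end
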